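(* Let $m,n\ge 0$ be integers. The skeleton (graph of vertices and edges) of the $(m,n)$-Hochschild polytope $\mathrm{Hoch}(m,n)$, oriented in the direction $\boldsymbol{\omega}_{m+n}=(m+n,\dots,1)-(1,\dots,m+n)$ (i.e. each edge is oriented from its endpoint with smaller to its endpoint with larger scalar product with $\boldsymbol{\omega}_{m+n}$), is isomorphic to the right rotation digraph on unary $m$-lighted $n$-shades.
   Context: Write $[k]=\{1,\dots,k\}$. **Shades.** An $m$-lighted $n$-shade $\mathbb{S}$ is a pair of sequences $S=(s_1,\dots,s_\ell)$ and $(c_1,\dots,c_\ell)$ of the same length $\ell\ge 0$, where each $s_i$ is a (possibly empty) tuple of positive integers, the sum of all entries of all the tuples is $n$, the $c_i$ are pairwise disjoint (possibly empty) subsets of $[m]$ with union $[m]$, and $c_i\neq\varnothing$ whenever $s_i$ is the empty tuple. The sequences are read from top to bottom ("below" means larger index). An index $i$ with $c_i\ne\varnothing$ is called a cut, with labels $c_i$. Put $|S|=\ell$ and $\|S\|=\sum_i|s_i|$, where $|s_i|$ is the length of $s_i$. The rank of $\mathbb{S}$ is $m-|S|+\|S\|$. $\mathbb{S}$ is unary if it has rank $0$, i.e. for each $i$, either $s_i$ is empty and $c_i$ is a singleton, or $c_i=\varnothing$ and $s_i$ has exactly one entry (a "singleton tuple"). **Right rotation digraph.** Directed graph on unary $m$-lighted $n$-shades with an edge from $\mathbb{S}$ to $\mathbb{S}'$ whenever $\mathbb{S}'$ is obtained from $\mathbb{S}$ by one of: (i) replacing a singleton tuple $(r)$ by two consecutive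 singleton tuples $(s),(t)$ (with $(s)$ above $(t)$), where $r=s+t$, $s,t\ge1$; (ii) exchanging a singleton tuple with a cut immediately below it (so that the cut moves above it); (iii) exchanging the labels of two consecutive cuts with no singleton tuple in between, where in $\mathbb{S}$ the larger label is above the smaller one, and in $\mathbb{S}'$ the smaller label is above the larger one. **Hochschild polytope.** For an entry $x$ of a tuple $s_i$, the preceding sum $ps(x)$ is $m$ plus the sum of all entries of $s_1,\dots,s_{i-1}$ plus the sum of the entries of $s_i$ weakly before $x$. For $\mathbb{S}$ unary with values $s_1,\dots,s_r$ of its singleton tuples from top to bottom, the point $\boldsymbol{a}(\mathbb{S})\in\mathbb{R}^{m+n}$ has $p$-th coordinate: if $p\le m$, the number of cuts weakly below the cut labeled $p$ plus the sum of the entries $s_i$ below the cut labeled $p$; if $p=ps(s_j)$ for some $j\in[r]$, $1+s_j(m+n-p+c_p)+\binom{s_j}{2}$, where $c_p$ is the number of cuts below $s_j$; and $1$ otherwise. $\mathrm{Hoch}(m,n)$ is the convex hull of the points $\boldsymbol{a}(\mathbb{S})$ over all unary $m$-lighted $n$-shades $\mathbb{S}$. *)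

theory Defs
  imports
    "HOL-Analysis.Analysis"
    "Graph_Theory.Pair_Digraph"
    "Graph_Theory.Digraph_Isomorphism"
begin

text \<open>A shade is the list, from top to bottom, of its pairs (tuple, label set). Positions are
  therefore 0-based and ``below'' means larger position; labels are taken from \<open>{1..m}\<close>.\<close>

type_synonym shade = "(nat list \<times> nat set) list"

definition tuple_at :: "shade \<Rightarrow> nat \<Rightarrow> nat list" where
  "tuple_at S i = fst (S ! i)"

definition labels_at :: "shade \<Rightarrow> nat \<Rightarrow> nat set" where
  "labels_at S i = snd (S ! i)"

definition shades :: "nat \<Rightarrow> nat \<Rightarrow> shade set" where
  "shades m n = {S.
     (\<forall>i<length S. \<forall>x\<in>set (tuple_at S i). 0 < x) \<and>
     (\<Sum>i<length S. sum_list (tuple_at S i)) = n \<and>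
     disjoint_family_on (labels_at S) {..<length S} \<and>
     (\<Union>i<length S. labels_at S i) = {1..m} \<and>
     (\<forall>i<length S. tuple_at S i = [] \<longrightarrow> labels_at S i \<noteq> {})}"

definition shade_rank :: "nat \<Rightarrow> shade \<Rightarrow> int" where
  "shade_rank m S = int m - int (length S) + int (\<Sum>i<length S. length (tuple_at S i))"

definition unary_shades :: "nat \<Rightarrow> nat \<Rightarrow> shade set" where
  "unary_shades m n = {S \<in> shades m n. shade_rank m S = 0}"

text \<open>In a unary shade a singleton tuple is an entry \<open>([r], {})\<close> and a cut is an entry
  \<open>([], {a})\<close>.\<close>

inductive right_rotation :: "shade \<Rightarrow> shade \<Rightarrow> bool" where
  split_tuple: "1 \<le> s \<Longrightarrow> 1 \<le> t \<Longrightarrow> r = s + t \<Longrightarrow>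
    right_rotation (xs @ [([r], {})] @ ys) (xs @ [([s], {}), ([t], {})] @ ys)"
| raise_cut:
    "right_rotation (xs @ [([r], {}), ([], {a})] @ ys) (xs @ [([], {a}), ([r], {})] @ ys)"
| swap_cuts: "a < b \<Longrightarrow>
    right_rotation (xs @ [([], {b}), ([], {a})] @ ys) (xs @ [([], {a}), ([], {b})] @ ys)"

definition right_rotation_digraph :: "nat \<Rightarrow> nat \<Rightarrow> shade pair_pre_digraph" where
  "right_rotation_digraph m n =
     \<lparr> pverts = unary_shades m n,
       parcs = {(S, S'). S \<in> unary_shades m n \<and> S' \<in> unary_shades m n \<and> right_rotation S S'} \<rparr>"

text \<open>Here \<open>k\<close> is the 0-based position of the entry within the \<open>i\<close>-th tuple, so that
  \<open>take (Suc k)\<close> yields the entries weakly before it.\<close>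

definition preceding_sum :: "nat \<Rightarrow> shade \<Rightarrow> nat \<Rightarrow> nat \<Rightarrow> nat" where
  "preceding_sum m S i k =
     m + (\<Sum>j<i. sum_list (tuple_at S j)) + sum_list (take (Suc k) (tuple_at S i))"

definition cut_position :: "shade \<Rightarrow> nat \<Rightarrow> nat" where
  "cut_position S p = (THE i. i < length S \<and> p \<in> labels_at S i)"

definition tuple_position_at_sum :: "nat \<Rightarrow> shade \<Rightarrow> nat \<Rightarrow> nat \<Rightarrow> bool" where
  "tuple_position_at_sum m S p i \<longleftrightarrow>
     i < length S \<and> tuple_at S i \<noteq> [] \<and> preceding_sum m S i 0 = p"

definition tuple_position :: "nat \<Rightarrow> shade \<Rightarrow> nat \<Rightarrow> nat" where
  "tuple_position m S p = (THE i. tuple_position_at_sum m S p i)"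

definition cuts_weakly_below :: "shade \<Rightarrow> nat \<Rightarrow> nat" where
  "cuts_weakly_below S i = card {j. i \<le> j \<and> j < length S \<and> labels_at S j \<noteq> {}}"

definition cuts_below :: "shade \<Rightarrow> nat \<Rightarrow> nat" where
  "cuts_below S i = card {j. i < j \<and> j < length S \<and> labels_at S j \<noteq> {}}"

definition entries_below :: "shade \<Rightarrow> nat \<Rightarrow> nat" where
  "entries_below S i = (\<Sum>j\<in>{i<..<length S}. sum_list (tuple_at S j))"

text \<open>The \<open>p\<close>-th coordinate of the point of a unary shade, for \<open>1 \<le> p \<le> m + n\<close>.
  The position selected by \<open>THE\<close> exists and is unique in each branch where it is used.\<close>

definition hoch_coord :: "nat \<Rightarrow> nat \<Rightarrow> shade \<Rightarrow> nat \<Rightarrow> real" where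
  "hoch_coord m n S p =
     (if p \<le> m then
        let i = cut_position S p
        in real (cuts_weakly_below S i) + real (entries_below S i)
      else if \<exists>i. tuple_position_at_sum m S p i then
        let i = tuple_position m S p; s = hd (tuple_at S i)
        in 1 + real s * (real (m + n) - real p + real (cuts_below S i)) + real (s choose 2)
      else 1)"

text \<open>The space of dimension \<open>m + n\<close> is given by distinct standard basis vectors
  \<open>e 1, \<dots>, e (m + n)\<close> of a Euclidean space. When \<open>DIM('a) = m + n\<close> this is the whole space;
  allowing larger spaces covers \<open>m + n = 0\<close>, as every \<open>euclidean_space\<close> type has positive
  dimension. The face structure of a polytope does not depend on the ambient space.\<close>

definition coord_basis :: "nat \<Rightarrow> (nat \<Rightarrow> 'a::euclidean_space) \<Rightarrow> bool" where
  "coord_basis d e \<longleftrightarrow> inj_on e {1..d} \<and> e ` {1..d} \<subseteq> Basis"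

definition hoch_point ::
  "(nat \<Rightarrow> 'a::euclidean_space) \<Rightarrow> nat \<Rightarrow> nat \<Rightarrow> shade \<Rightarrow> 'a" where
  "hoch_point e m n S = (\<Sum>p=1..m+n. hoch_coord m n S p *\<^sub>R e p)"

definition Hoch :: "(nat \<Rightarrow> 'a::euclidean_space) \<Rightarrow> nat \<Rightarrow> nat \<Rightarrow> 'a set" where
  "Hoch e m n = convex hull (hoch_point e m n ` unary_shades m n)"

definition omega_dir :: "(nat \<Rightarrow> 'a::euclidean_space) \<Rightarrow> nat \<Rightarrow> 'a" where
  "omega_dir e d = (\<Sum>p=1..d. ((real (d + 1) - real p) - real p) *\<^sub>R e p)"

definition oriented_skeleton :: "'a::euclidean_space \<Rightarrow> 'a set \<Rightarrow> 'a pair_pre_digraph" where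
  "oriented_skeleton w P =
     \<lparr> pverts = {v. v extreme_point_of P},
       parcs = {(u, v). closed_segment u v edge_of P \<and> w \<bullet> u < w \<bullet> v} \<rparr>"

text \<open>Needed for the orientation to be defined on every edge; \<open>oriented_skeleton\<close> silently drops
  edges orthogonal to \<open>w\<close>.\<close>

definition generic_direction :: "'a::euclidean_space \<Rightarrow> 'a set \<Rightarrow> bool" where
  "generic_direction w P \<longleftrightarrow>
     (\<forall>u v. closed_segment u v edge_of P \<longrightarrow> w \<bullet> u \<noteq> w \<bullet> v)"

end

theory Submission
  imports Defs
begin

text \<open>\<open>Hoch(m, n)\<close> is a simple polytope. Every proper lower part of a unary shade \<open>S\<close>, with set \<open>U\<close> of
  coordinates, gives the inequality \<open>\<Sum>p\<in>U. x p \<ge> |U| (|U| + 1) / 2\<close>, valid on all points and tight at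
  the point of \<open>S\<close>; so does every coordinate \<open>p\<close> in the interior of a tuple, with \<open>U = {p}\<close>. The linear
  forms of these sets, together with the constant total sum, separate vectors, and for each of them
  exactly one rotation of \<open>S\<close>, in either direction, keeps all the others tight. Hence the rotations
  span the cone of the polytope at each vertex and give its edges. A right rotation increases a
  coordinate at the expense of one with larger index, and the coefficients of \<open>\<omega>\<close> decrease.\<close>

section \<open>Skeletons of simple polytopes\<close>

text \<open>The constants in the points come from the permutahedron. Let \<open>w\<close> be the
  number of labels plus the sum of the entries below a given entry. A cut gets the value w + 1. A
  tuple of value \<open>r\<close> gets (w+1) + ... + (w+r) in total: a 1 on each of the
  \<open>r\<close> coordinates of its block, and the remaining r w + r (r - 1) / 2 on the last of
  them. A lower part that fills the set U therefore has total 1 + 2 + ... + |U|, which is the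
  right-hand side of its inequality. What an entry contributes depends only on what lies below it,
  so everything is recursive on the list, whose tails are the lower parts. The obstacle is that this
  inequality fails for arbitrary U: two interior coordinates of one tuple sum to 2 < 3. It holds for
  those U that contain, with any coordinate above \<open>m\<close>, all larger ones. Supports of
  lower parts have this form; interior coordinates do not and must be treated as single
  coordinates.\<close>

text \<open>\<open>C i\<close> plays the role of the inner normals of the facets through the vertex \<open>a i\<close>, and \<open>W\<close> that of
  the direction space of the affine hull.\<close>

locale simple_polytope =
  fixes I :: "'i set" and a :: "'i \<Rightarrow> 'a::euclidean_space" and W :: "'a set"
    and C :: "'i \<Rightarrow> 'a set" and adj :: "'i \<Rightarrow> 'i \<Rightarrow> bool"
  assumes finite_I: "finite I"
    and inj_a: "inj_on a I"
    and subspace_W: "subspace W"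
    and diff_in_W: "i \<in> I \<Longrightarrow> j \<in> I \<Longrightarrow> a j - a i \<in> W"
    and finite_C: "i \<in> I \<Longrightarrow> finite (C i)"
    and valid: "i \<in> I \<Longrightarrow> c \<in> C i \<Longrightarrow> j \<in> I \<Longrightarrow> c \<bullet> a i \<le> c \<bullet> a j"
    and separating: "i \<in> I \<Longrightarrow> y \<in> W \<Longrightarrow> (\<And>c. c \<in> C i \<Longrightarrow> c \<bullet> y = 0) \<Longrightarrow> y = 0"
    and neighbour: "i \<in> I \<Longrightarrow> c \<in> C i \<Longrightarrow>
      \<exists>j\<in>I. adj i j \<and> i \<noteq> j \<and> (\<forall>c'\<in>C i - {c}. c' \<bullet> a j = c' \<bullet> a i)"
    and adj_tight: "i \<in> I \<Longrightarrow> j \<in> I \<Longrightarrow> adj i j \<Longrightarrow>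
      i \<noteq> j \<and> (\<exists>c\<in>C i. \<forall>c'\<in>C i - {c}. c' \<bullet> a j = c' \<bullet> a i)"
begin

lemma eq_if_tight:
  assumes "i \<in> I" "j \<in> I" "\<And>c. c \<in> C i \<Longrightarrow> c \<bullet> a j = c \<bullet> a i"
  shows "i = j"
proof -
  have "a j - a i = 0"
    using assms diff_in_W by (intro separating[of i]) (auto simp: inner_diff_right)
  thus ?thesis using assms inj_a by (auto dest: inj_onD)
qed

text \<open>Equality would make every normal at \<open>i\<close> tight at \<open>j\<close>, and
  \<open>eq_if_tight\<close> would identify the two.\<close>

lemma strict:
  assumes "i \<in> I" "j \<in> I" "i \<noteq> j" "c \<in> C i" "\<forall>c'\<in>C i - {c}. c' \<bullet> a j = c' \<bullet> a i"
  shows "c \<bullet> a i < c \<bullet> a j"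
  using eq_if_tight[of i j] assms valid[of i c j] by fastforce

text \<open>Each normal in \<open>D\<close> is minimal at \<open>a i\<close>, so their sum attains
  its minimum over the vertices only where every summand does. A single supporting hyperplane thus
  cuts out the common tight set.\<close>

lemma face_of_tight:
  assumes i: "i \<in> I" and D: "D \<subseteq> C i"
  shows "convex hull (a ` {j\<in>I. \<forall>c\<in>D. c \<bullet> a j = c \<bullet> a i}) face_of convex hull (a ` I)"
proof -
  let ?J = "{j\<in>I. \<forall>c\<in>D. c \<bullet> a j = c \<bullet> a i}"
  let ?f = "\<Sum>D" and ?P = "convex hull (a ` I)"
  let ?H = "{x. ?f \<bullet> x = ?f \<bullet> a i}"
  have fin: "finite D" using D finite_C[OF i] finite_subset by blast
  have ge: "?f \<bullet> a i \<le> ?f \<bullet> a j" if "j \<in> I" for j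
    unfolding inner_sum_left using D valid[OF i _ that] by (intro sum_mono) auto
  have eq: "c \<bullet> a j = c \<bullet> a i" if "j \<in> I" "?f \<bullet> a j = ?f \<bullet> a i" "c \<in> D" for j c
  proof -
    have "(\<Sum>c\<in>D. c \<bullet> a j - c \<bullet> a i) = 0"
      using that by (simp add: sum_subtractf inner_sum_left)
    moreover have "0 \<le> c \<bullet> a j - c \<bullet> a i" if "c \<in> D" for c
      using D valid[OF i _ \<open>j \<in> I\<close>] that by auto
    ultimately show ?thesis
      using sum_nonneg_eq_0_iff[OF fin, of "\<lambda>c. c \<bullet> a j - c \<bullet> a i"] that by auto
  qed
  have "?P \<subseteq> {x. ?f \<bullet> x \<ge> ?f \<bullet> a i}"
    by (rule hull_minimal) (auto simp: convex_halfspace_ge ge)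
  hence face: "(?P \<inter> ?H) face_of ?P"
    by (intro face_of_Int_supporting_hyperplane_ge convex_convex_hull) auto
  obtain s where s: "s \<subseteq> a ` I" "?P \<inter> ?H = convex hull s"
    using face_of_convex_hull_subset[OF _ face] finite_I finite_imp_compact by blast
  have "s \<subseteq> ?P \<inter> ?H" unfolding s(2) by (rule hull_subset)
  have "s \<subseteq> a ` ?J"
  proof
    fix x assume "x \<in> s"
    then obtain j where j: "j \<in> I" "x = a j" using s(1) by blast
    have "?f \<bullet> a j = ?f \<bullet> a i" using \<open>s \<subseteq> ?P \<inter> ?H\<close> \<open>x \<in> s\<close> j(2) by blast
    thus "x \<in> a ` ?J" using eq j by blast
  qed
  hence "convex hull s \<subseteq> convex hull (a ` ?J)" by (rule hull_mono)
  moreover have "convex hull (a ` ?J) \<subseteq> ?P \<inter> ?H"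
  proof (rule hull_minimal)
    show "convex (?P \<inter> ?H)" by (intro convex_Int convex_convex_hull convex_hyperplane)
  qed (auto simp: hull_inc inner_sum_left intro!: sum.cong)
  ultimately have "convex hull (a ` ?J) = ?P \<inter> ?H" unfolding s(2) by (rule subset_antisym[rotated])
  thus ?thesis using face by simp
qed

lemma extreme_point: "x extreme_point_of convex hull (a ` I) \<longleftrightarrow> x \<in> a ` I"
proof
  assume "x \<in> a ` I"
  then obtain i where i: "i \<in> I" "x = a i" by auto
  have "{j\<in>I. \<forall>c\<in>C i. c \<bullet> a j = c \<bullet> a i} = {i}"
    using eq_if_tight[OF i(1)] i(1) by auto
  with face_of_tight[OF i(1) order_refl] show "x extreme_point_of convex hull (a ` I)"
    by (simp add: i face_of_singleton)
qed (rule extreme_point_of_convex_hull)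

text \<open>Evaluating the functionals of a vertex on an arbitrary vertex yields the coefficients with respect to
  the edge directions.\<close>

lemma cone_at_vertex:
  assumes i: "i \<in> I" and k: "k \<in> I"
  obtains nb l where "\<And>c. c \<in> C i \<Longrightarrow> nb c \<in> I \<and> adj i (nb c) \<and> i \<noteq> nb c \<and> 0 \<le> l c"
    "a k - a i = (\<Sum>c\<in>C i. l c *\<^sub>R (a (nb c) - a i))"
proof -
  have "\<forall>c\<in>C i. \<exists>j\<in>I. adj i j \<and> i \<noteq> j \<and> (\<forall>c'\<in>C i - {c}. c' \<bullet> a j = c' \<bullet> a i)"
    using neighbour[OF i] by blast
  then obtain nb where nb: "\<And>c. c \<in> C i \<Longrightarrow> nb c \<in> I" "\<And>c. c \<in> C i \<Longrightarrow> adj i (nb c)"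
    "\<And>c. c \<in> C i \<Longrightarrow> i \<noteq> nb c"
    "\<And>c c'. c \<in> C i \<Longrightarrow> c' \<in> C i \<Longrightarrow> c' \<noteq> c \<Longrightarrow> c' \<bullet> a (nb c) = c' \<bullet> a i"
    by (metis Diff_iff singletonD)
  have pos: "0 < c \<bullet> a (nb c) - c \<bullet> a i" if "c \<in> C i" for c
    using strict[of i "nb c" c] nb that i by auto
  define l where "l c = (c \<bullet> a k - c \<bullet> a i) / (c \<bullet> a (nb c) - c \<bullet> a i)" for c
  have l: "0 \<le> l c" if "c \<in> C i" for c
    unfolding l_def using pos[OF that] valid[OF i that k] by auto
  let ?y = "(a k - a i) - (\<Sum>c\<in>C i. l c *\<^sub>R (a (nb c) - a i))"
  have "?y = 0"
  proof (rule separating[OF i])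
    show "?y \<in> W"
      using diff_in_W i k nb(1)
      by (intro subspace_diff[OF subspace_W, of "a k - a i"] subspace_sum[OF subspace_W]
          subspace_scale[OF subspace_W]) auto
    fix c assume c: "c \<in> C i"
    \<comment> \<open>\<open>c\<close> vanishes on the edge directions that belong to the other
      normals, so only its own term survives.\<close>
    have "(\<Sum>c'\<in>C i. l c' * (c \<bullet> (a (nb c') - a i))) =
        (\<Sum>c'\<in>C i. if c' = c then l c * (c \<bullet> (a (nb c) - a i)) else 0)"
      using nb(4) c by (intro sum.cong) (auto simp: inner_diff_right)
    also have "\<dots> = c \<bullet> a k - c \<bullet> a i"
      using pos[OF c] finite_C[OF i] c by (simp add: l_def inner_diff_right)
    finally show "c \<bullet> ?y = 0"
      by (simp add: inner_diff_right inner_sum_right)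
  qed
  thus ?thesis using that[of nb l] nb l by auto
qed

text \<open>A hyperplane exposing the segment contains \<open>a i\<close> and \<open>a k\<close> and
  has all vertices on one side. In the conic decomposition of \<open>a k - a i\<close>, a neighbour
  with positive coefficient therefore lies on the hyperplane, hence on the segment; being a vertex
  other than \<open>a i\<close>, it is \<open>a k\<close>.\<close>

lemma edge_of_imp_adj:
  assumes i: "i \<in> I" and k: "k \<in> I" and "i \<noteq> k"
    and face: "closed_segment (a i) (a k) face_of convex hull (a ` I)"
  shows "adj i k"
proof -
  let ?P = "convex hull (a ` I)"
  obtain nb l where nb: "\<And>c. c \<in> C i \<Longrightarrow> nb c \<in> I \<and> adj i (nb c) \<and> i \<noteq> nb c \<and> 0 \<le> l c"
    and sum: "a k - a i = (\<Sum>c\<in>C i. l c *\<^sub>R (a (nb c) - a i))"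
    using cone_at_vertex[OF i k] by blast
  have "a i \<noteq> a k" using inj_a i k \<open>i \<noteq> k\<close> by (auto dest: inj_onD)
  then obtain c where c: "c \<in> C i" "l c \<noteq> 0"
    using sum by (metis (no_types, lifting) right_minus_eq scale_zero_left sum.neutral)
  have "closed_segment (a i) (a k) exposed_face_of ?P"
    using face finite_I by (simp add: exposed_face_of_polyhedron polyhedron_convex_hull)
  then obtain h b where h: "?P \<subseteq> {x. h \<bullet> x \<le> b}" "closed_segment (a i) (a k) = ?P \<inter> {x. h \<bullet> x = b}"
    by (auto simp: exposed_face_of_def)
  have hb: "h \<bullet> a i = b" "h \<bullet> a k = b" using h(2) ends_in_segment by blast+
  have le: "h \<bullet> a j \<le> b" if "j \<in> I" for j
    using h(1) that hull_subset[of "a ` I" convex] by blast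
  have "(\<Sum>c\<in>C i. l c * (b - h \<bullet> a (nb c))) = - (h \<bullet> (a k - a i))"
    unfolding sum by (simp add: inner_sum_right inner_diff_right hb algebra_simps sum_subtractf)
  also have "\<dots> = 0" by (simp add: hb inner_diff_right)
  finally have "l c * (b - h \<bullet> a (nb c)) = 0"
    using sum_nonneg_eq_0_iff[OF finite_C[OF i], of "\<lambda>c. l c * (b - h \<bullet> a (nb c))"] nb le c(1)
    by auto
  hence "a (nb c) \<in> closed_segment (a i) (a k)"
    unfolding h(2) using c nb by (auto simp: hull_inc)
  hence "a (nb c) extreme_point_of closed_segment (a i) (a k)"
    using extreme_point_of_face[OF face] extreme_point nb c(1) by auto
  hence "a (nb c) = a k"
    using nb[OF c(1)] i inj_a by (auto simp: extreme_point_of_segment dest: inj_onD)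
  thus ?thesis using nb[OF c(1)] k inj_a by (auto dest: inj_onD)
qed

text \<open>Vertices tight for all normals at \<open>i\<close> except \<open>c\<close> lie on one
  ray from \<open>a i\<close>, since their difference from \<open>a i\<close> is determined by its
  value under \<open>c\<close>. If there were two besides \<open>a i\<close>, the nearer one would
  lie inside a segment and not be extreme.\<close>

lemma adj_imp_face_of:
  assumes i: "i \<in> I" and k: "k \<in> I" and "adj i k"
  shows "closed_segment (a i) (a k) face_of convex hull (a ` I)"
proof -
  obtain c where c: "i \<noteq> k" "c \<in> C i" and tight: "\<forall>c'\<in>C i - {c}. c' \<bullet> a k = c' \<bullet> a i"
    using adj_tight[OF assms] by blast
  have pos: "0 < c \<bullet> a k - c \<bullet> a i" using strict[OF i k c tight] by simp
  have collinear: "a j = a i \<or> a j = a k"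
    if j: "j \<in> I" and t: "\<forall>c'\<in>C i - {c}. c' \<bullet> a j = c' \<bullet> a i" for j
  proof (cases "j = i")
    case False
    \<comment> \<open>The ratio of the increases along \<open>c\<close>, the only normal at
      \<open>i\<close> on which the two differences are nonzero.\<close>
    define r where "r = (c \<bullet> a j - c \<bullet> a i) / (c \<bullet> a k - c \<bullet> a i)"
    have "0 < r" unfolding r_def using strict[OF i j _ c(2) t] False pos by auto
    have "(a j - a i) - r *\<^sub>R (a k - a i) = 0"
    proof (rule separating[OF i])
      show "(a j - a i) - r *\<^sub>R (a k - a i) \<in> W"
        using diff_in_W i j k
        by (intro subspace_diff[OF subspace_W, of "a j - a i"] subspace_scale[OF subspace_W]) auto
      fix c' assume "c' \<in> C i"
      thus "c' \<bullet> ((a j - a i) - r *\<^sub>R (a k - a i)) = 0"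
        using pos t tight by (cases "c' = c") (auto simp: inner_diff_right r_def)
    qed
    hence aj: "a j = (1 - r) *\<^sub>R a i + r *\<^sub>R a k" by (simp add: algebra_simps)
    have ext: "a j extreme_point_of convex hull (a ` I)" "a k extreme_point_of convex hull (a ` I)"
      "a i extreme_point_of convex hull (a ` I)"
      using i j k extreme_point by auto
    consider "r < 1" | "r = 1" | "1 < r" by linarith
    thus ?thesis
    proof cases
      assume "r < 1"
      hence "a j \<in> open_segment (a i) (a k)"
        using \<open>0 < r\<close> aj c(1) i k inj_a by (auto simp: in_segment dest: inj_onD)
      thus ?thesis using ext by (auto simp: extreme_point_of_def)
    next
      assume "1 < r"
      have "a k = (1 - 1 / r) *\<^sub>R a i + (1 / r) *\<^sub>R a j"
        using \<open>0 < r\<close> by (simp add: aj algebra_simps)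
      hence "a k \<in> open_segment (a i) (a j)"
        using \<open>1 < r\<close> False i j inj_a
        by (auto simp: in_segment dest: inj_onD intro!: exI[of _ "1 / r"])
      thus ?thesis using ext by (auto simp: extreme_point_of_def)
    qed (use aj in auto)
  qed auto
  let ?J = "{j\<in>I. \<forall>c'\<in>C i - {c}. c' \<bullet> a j = c' \<bullet> a i}"
  have "a ` ?J = {a i, a k}" using collinear i k tight by auto
  thus ?thesis using face_of_tight[OF i, of "C i - {c}"]
    by (auto simp: segment_convex_hull)
qed

theorem edge_of_iff:
  "closed_segment u v edge_of convex hull (a ` I) \<longleftrightarrow> (\<exists>i\<in>I. \<exists>k\<in>I. u = a i \<and> v = a k \<and> adj i k)"
proof
  assume L: "closed_segment u v edge_of convex hull (a ` I)"
  hence face: "closed_segment u v face_of convex hull (a ` I)" and dim: "aff_dim (closed_segment u v) = 1"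
    by (auto simp: edge_of_def)
  have "u \<noteq> v" using dim by auto
  have "u \<in> a ` I" "v \<in> a ` I"
    using extreme_point_of_face[OF face] extreme_point extreme_point_of_segment by blast+
  then obtain i k where "i \<in> I" "k \<in> I" "u = a i" "v = a k" by blast
  thus "\<exists>i\<in>I. \<exists>k\<in>I. u = a i \<and> v = a k \<and> adj i k"
    using edge_of_imp_adj face \<open>u \<noteq> v\<close> by blast
next
  assume "\<exists>i\<in>I. \<exists>k\<in>I. u = a i \<and> v = a k \<and> adj i k"
  then obtain i k where ik: "i \<in> I" "k \<in> I" "u = a i" "v = a k" "adj i k" by blast
  hence "u \<noteq> v" using adj_tight[of i k] inj_a by (auto dest: inj_onD)
  thus "closed_segment u v edge_of convex hull (a ` I)"
    using adj_imp_face_of[OF ik(1,2,5)] ik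
    by (simp add: edge_of_def segment_convex_hull aff_dim_convex_hull aff_dim_2)
qed

end

section \<open>Unary shades and their coordinates\<close>

text \<open>Unarity in local form: the rank is a global count, whereas this condition passes to
  tails of the list.\<close>

definition unary_entry :: "nat list \<times> nat set \<Rightarrow> bool" where
  "unary_entry x \<longleftrightarrow> (\<exists>r\<ge>1. x = ([r], {})) \<or> (\<exists>a. x = ([], {a}))"

primrec entries_sum :: "shade \<Rightarrow> nat" where
  "entries_sum [] = 0"
| "entries_sum (x # S) = sum_list (fst x) + entries_sum S"

primrec num_labels :: "shade \<Rightarrow> nat" where
  "num_labels [] = 0"
| "num_labels (x # S) = card (snd x) + num_labels S"

primrec label_set :: "shade \<Rightarrow> nat set" where
  "label_set [] = {}"
| "label_set (x # S) = snd x \<union> label_set S"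

definition weight :: "shade \<Rightarrow> nat" where
  "weight S = entries_sum S + num_labels S"

lemma entries_sum_append [simp]: "entries_sum (xs @ ys) = entries_sum xs + entries_sum ys"
  by (induction xs) auto

lemma num_labels_append [simp]: "num_labels (xs @ ys) = num_labels xs + num_labels ys"
  by (induction xs) auto

lemma label_set_append [simp]: "label_set (xs @ ys) = label_set xs \<union> label_set ys"
  by (induction xs) auto

lemma weight_simps [simp]:
  "weight [] = 0" "weight (x # S) = sum_list (fst x) + card (snd x) + weight S"
  by (auto simp: weight_def)

lemma entries_sum_nth: "entries_sum S = (\<Sum>i<length S. sum_list (tuple_at S i))"
proof -
  have "entries_sum S = sum_list (map (sum_list \<circ> fst) S)" by (induction S) auto
  thus ?thesis by (simp add: sum_list_sum_nth tuple_at_def atLeast0LessThan)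
qed

lemma num_labels_nth: "num_labels S = (\<Sum>i<length S. card (labels_at S i))"
proof -
  have "num_labels S = sum_list (map (card \<circ> snd) S)" by (induction S) auto
  thus ?thesis by (simp add: sum_list_sum_nth labels_at_def atLeast0LessThan)
qed

lemma label_set_nth: "label_set S = (\<Union>i<length S. labels_at S i)"
proof -
  have "label_set S = (\<Union>x\<in>set S. snd x)" by (induction S) auto
  also have "set S = (\<lambda>i. S ! i) ` {..<length S}" unfolding set_conv_nth by blast
  finally show ?thesis by (simp add: labels_at_def)
qed

lemma finite_label_set: "\<forall>x\<in>set S. unary_entry x \<Longrightarrow> finite (label_set S)"
  by (induction S) (auto simp: unary_entry_def)

lemma card_label_set_le: "\<forall>x\<in>set S. unary_entry x \<Longrightarrow> card (label_set S) \<le> num_labels S"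
proof (induction S)
  case (Cons x S)
  have "card (label_set (x # S)) \<le> card (snd x) + card (label_set S)" by (simp add: card_Un_le)
  thus ?case using Cons by fastforce
qed simp

text \<open>Equality of \<open>card (label_set S)\<close> and \<open>num_labels S\<close> encodes
  that the labels are pairwise disjoint. The tail inherits it because neither an overlap nor a
  deficit in the tail can be compensated by the head.\<close>

lemma card_label_set_Cons:
  assumes "\<forall>y\<in>set (x # S). unary_entry y" "card (label_set (x # S)) = num_labels (x # S)"
  shows "card (label_set S) = num_labels S" "snd x \<inter> label_set S = {}"
proof -
  have fin: "finite (snd x)" "finite (label_set S)"
    using finite_label_set[of "x # S"] assms(1) by auto
  have "card (label_set S) \<le> num_labels S" using assms(1) by (simp add: card_label_set_le)
  moreover have "card (snd x) + card (label_set S) = card (snd x \<union> label_set S) + card (snd x \<inter> label_set S)"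
    using fin by (rule card_Un_Int)
  ultimately have "card (label_set S) = num_labels S" "card (snd x \<inter> label_set S) = 0"
    using assms(2) by auto
  thus "card (label_set S) = num_labels S" "snd x \<inter> label_set S = {}" using fin by auto
qed

lemma disjoint_labels:
  assumes "\<forall>x\<in>set S. unary_entry x" "card (label_set S) = num_labels S"
  shows "disjoint_family_on (labels_at S) {..<length S}"
proof -
  have "sorted_wrt (\<lambda>x y. snd x \<inter> snd y = {}) S"
    using assms
  proof (induction S)
    case (Cons x S)
    have "snd y \<subseteq> label_set S" if "y \<in> set S" for y
      using that by (induction S) auto
    thus ?case using Cons card_label_set_Cons[of x S] by fastforce
  qed simp
  hence "labels_at S i \<inter> labels_at S j = {}" if "i < j" "j < length S" for i j
    using that by (auto simp: sorted_wrt_iff_nth_less labels_at_def)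
  thus ?thesis by (auto simp: disjoint_family_on_def) (metis disjoint_iff linorder_neqE_nat)
qed

text \<open>At every index the tuple length plus the number of labels is at least 1, and rank 0 says
  that these numbers sum to the length of the shade; so each of them is 1.\<close>

lemma unary_shades_iff:
  "S \<in> unary_shades m n \<longleftrightarrow>
    (\<forall>x\<in>set S. unary_entry x) \<and> label_set S = {1..m} \<and> num_labels S = m \<and> entries_sum S = n"
  (is "_ \<longleftrightarrow> ?R")
proof
  assume L: "S \<in> unary_shades m n"
  hence pos: "\<And>i x. i < length S \<Longrightarrow> x \<in> set (tuple_at S i) \<Longrightarrow> 0 < x"
    and n: "(\<Sum>i<length S. sum_list (tuple_at S i)) = n"
    and disj: "disjoint_family_on (labels_at S) {..<length S}"
    and lab: "(\<Union>i<length S. labels_at S i) = {1..m}"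
    and ne: "\<And>i. i < length S \<Longrightarrow> tuple_at S i = [] \<Longrightarrow> labels_at S i \<noteq> {}"
    and rank_0: "shade_rank m S = 0"
    by (auto simp: unary_shades_def shades_def)
  have rank: "m + (\<Sum>i<length S. length (tuple_at S i)) = length S"
    using rank_0 unfolding shade_rank_def by linarith
  have fin: "finite (labels_at S i)" if "i < length S" for i
  proof -
    have "labels_at S i \<subseteq> {1..m}" using lab that by blast
    thus ?thesis using finite_subset by blast
  qed
  have m: "(\<Sum>i<length S. card (labels_at S i)) = m"
    using card_UN_disjoint'[OF disj] fin lab by auto
  define f where "f i = length (tuple_at S i) + card (labels_at S i)" for i
  have f1: "1 \<le> f i" if "i < length S" for i
    using ne[OF that] fin[OF that] by (cases "tuple_at S i") (auto simp: f_def Suc_le_eq card_gt_0_iff)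
  have "(\<Sum>i<length S. f i) = length S" using m rank by (simp add: f_def sum.distrib)
  hence "(\<Sum>i<length S. f i - 1) = 0" using f1 by (subst sum_subtractf_nat) auto
  hence f: "f i = 1" if "i < length S" for i
    using f1[OF that] that by (simp add: le_antisym)
  have "unary_entry x" if "x \<in> set S" for x
  proof -
    obtain i where i: "i < length S" "x = S ! i"
      using \<open>x \<in> set S\<close> by (metis in_set_conv_nth)
    have x: "x = (tuple_at S i, labels_at S i)" by (simp add: i tuple_at_def labels_at_def)
    show ?thesis
    proof (cases "tuple_at S i")
      case Nil
      hence "card (labels_at S i) = 1" using f[OF i(1)] by (simp add: f_def)
      thus ?thesis using Nil x by (auto simp: unary_entry_def card_1_singleton_iff)
    next
      case (Cons r rs)
      hence "rs = []" "card (labels_at S i) = 0" using f[OF i(1)] by (auto simp: f_def)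
      thus ?thesis using Cons x pos[OF i(1), of r] fin[OF i(1)]
        by (auto simp: unary_entry_def Suc_le_eq)
    qed
  qed
  thus ?R using n m lab by (simp add: entries_sum_nth num_labels_nth label_set_nth)
next
  assume R: ?R
  have entry: "unary_entry (S ! i)" if "i < length S" for i using R that by auto
  have "length (tuple_at S i) + card (labels_at S i) = 1" if "i < length S" for i
    using entry[OF that] by (auto simp: unary_entry_def tuple_at_def labels_at_def)
  hence "length S = (\<Sum>i<length S. length (tuple_at S i) + card (labels_at S i))" by simp
  also have "\<dots> = (\<Sum>i<length S. length (tuple_at S i)) + m"
    using R by (simp add: sum.distrib num_labels_nth)
  finally have "shade_rank m S = 0" unfolding shade_rank_def by linarith
  moreover have "disjoint_family_on (labels_at S) {..<length S}"
    using R by (intro disjoint_labels) auto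
  moreover have "\<forall>i<length S. (\<forall>x\<in>set (tuple_at S i). 0 < x) \<and> (tuple_at S i = [] \<longrightarrow> labels_at S i \<noteq> {})"
    using entry by (fastforce simp: unary_entry_def tuple_at_def labels_at_def)
  ultimately show "S \<in> unary_shades m n"
    using R by (auto simp: unary_shades_def shades_def entries_sum_nth label_set_nth)
qed

lemma finite_unary_shades: "finite (unary_shades m n)"
proof -
  let ?A = "(\<lambda>r. ([r], {})) ` {..n} \<union> (\<lambda>a. ([], {a})) ` {..m} :: (nat list \<times> nat set) set"
  have len: "length S \<le> weight S" if "\<forall>x\<in>set S. unary_entry x" for S
    using that by (induction S) (auto simp: unary_entry_def)
  have mem: "sum_list (fst x) \<le> entries_sum S" "snd x \<subseteq> label_set S" if "x \<in> set S" for x S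
    using that by (induction S) auto
  have "unary_shades m n \<subseteq> {S. set S \<subseteq> ?A \<and> length S \<le> m + n}"
  proof
    fix S assume "S \<in> unary_shades m n"
    hence S: "\<forall>x\<in>set S. unary_entry x" "label_set S = {1..m}" "num_labels S = m" "entries_sum S = n"
      by (simp_all add: unary_shades_iff)
    have "x \<in> ?A" if "x \<in> set S" for x
      using S mem[OF that] that by (auto simp: unary_entry_def)
    thus "S \<in> {S. set S \<subseteq> ?A \<and> length S \<le> m + n}"
      using len[OF S(1)] S by (auto simp: weight_def)
  qed
  moreover have "finite {S. set S \<subseteq> ?A \<and> length S \<le> m + n}"
    by (rule finite_lists_length_le) simp
  ultimately show ?thesis by (rule finite_subset)
qed

text \<open>The lower parts of unary shades, on which the inductions run.\<close>

definition lower_part :: "nat \<Rightarrow> nat \<Rightarrow> shade \<Rightarrow> bool" where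
  "lower_part m n S \<longleftrightarrow> (\<forall>x\<in>set S. unary_entry x) \<and> label_set S \<subseteq> {1..m} \<and>
     card (label_set S) = num_labels S \<and> entries_sum S \<le> n"

lemma unary_shades_lower_part: "S \<in> unary_shades m n \<Longrightarrow> lower_part m n S"
  by (simp add: unary_shades_iff lower_part_def)

lemma lower_part_cases:
  assumes "lower_part m n (x # S)"
  obtains (tuple) r where "x = ([r], {})" "1 \<le> r" "r + entries_sum S \<le> n" "lower_part m n S"
  | (cut) b where "x = ([], {b})" "1 \<le> b" "b \<le> m" "b \<notin> label_set S" "lower_part m n S"
proof -
  have "lower_part m n S" "snd x \<inter> label_set S = {}"
    using assms card_label_set_Cons[of x S] by (auto simp: lower_part_def)
  thus ?thesis using assms that by (auto simp: lower_part_def unary_entry_def)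
qed

lemma lower_part_induct [consumes 1, case_names Nil tuple cut]:
  assumes "lower_part m n S" and "P []"
    and "\<And>r S. 1 \<le> r \<Longrightarrow> r + entries_sum S \<le> n \<Longrightarrow> lower_part m n S \<Longrightarrow>
      lower_part m n (([r], {}) # S) \<Longrightarrow> P S \<Longrightarrow> P (([r], {}) # S)"
    and "\<And>b S. 1 \<le> b \<Longrightarrow> b \<le> m \<Longrightarrow> b \<notin> label_set S \<Longrightarrow> lower_part m n S \<Longrightarrow>
      lower_part m n (([], {b}) # S) \<Longrightarrow> P S \<Longrightarrow> P (([], {b}) # S)"
  shows "P S"
  using assms(1)
proof (induction S)
  case (Cons x S)
  show ?case using Cons.prems
    by (cases rule: lower_part_cases) (use Cons assms(3,4) in auto)
qed (use assms(2) in auto)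

lemma lower_part_suffix: "lower_part m n (xs @ ys) \<Longrightarrow> lower_part m n ys"
  by (induction xs) (auto elim: lower_part_cases)

lemma lower_partD:
  assumes "lower_part m n S"
  shows "label_set S \<subseteq> {1..m}" "entries_sum S \<le> n" "finite (label_set S)"
    "card (label_set S) = num_labels S"
  using assms finite_label_set by (auto simp: lower_part_def)

text \<open>The coordinates filled by the entries of \<open>S\<close>, where \<open>M = m + n\<close>: a cut fills its label,
  a tuple fills as many of the last \<open>n\<close> coordinates as its value.\<close>

definition support :: "nat \<Rightarrow> shade \<Rightarrow> nat set" where
  "support M S = label_set S \<union> {M - entries_sum S<..M}"

text \<open>The last summand vanishes for a cut, whose tuple has sum 0.\<close>

primrec coord :: "nat \<Rightarrow> shade \<Rightarrow> nat \<Rightarrow> real" where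
  "coord M [] p = 0"
| "coord M (x # S) p = coord M S p + (if p \<in> snd x then 1 + weight S else 0)
     + (if M - entries_sum (x # S) < p \<and> p \<le> M - entries_sum S then 1 else 0)
     + (if p = M - entries_sum S then sum_list (fst x) * weight S + (sum_list (fst x) choose 2) else 0)"

lemma support_Nil [simp]: "support M [] = {}"
  by (simp add: support_def)

section \<open>Supports and coordinates of lower parts\<close>

lemma support_cut: "support M (([], {b}) # S) = insert b (support M S)"
  by (simp add: support_def)

lemma support_tuple:
  "r + entries_sum S \<le> M \<Longrightarrow>
    support M (([r], {}) # S) = {M - entries_sum S - r<..M - entries_sum S} \<union> support M S"
  by (auto simp: support_def)

lemma finite_support: "lower_part m n S \<Longrightarrow> finite (support M S)"
  using lower_partD by (simp add: support_def)

lemma card_support: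
  assumes "lower_part m n S"
  shows "card (support (m + n) S) = weight S"
proof -
  \<comment> \<open>Labels are at most \<open>m\<close>, and the coordinates of tuples exceed
    \<open>m\<close> because \<open>entries_sum S \<le> n\<close>.\<close>
  have "label_set S \<inter> {m + n - entries_sum S<..m + n} = {}"
    using lower_partD(1,2)[OF assms] by force
  thus ?thesis using lower_partD[OF assms]
    by (simp add: support_def weight_def card_Un_disjoint)
qed

lemma support_unary_shade: "S \<in> unary_shades m n \<Longrightarrow> support (m + n) S = {1..m + n}"
  by (auto simp: unary_shades_iff support_def)

lemma coord_outside:
  assumes "lower_part m n S" "1 \<le> p" "p \<notin> support (m + n) S"
  shows "coord (m + n) S p = 0"
  using assms
  by (induction rule: lower_part_induct) (auto simp: support_cut support_tuple)

text \<open>Entries put on top write only outside the present support: cut labels are fresh, and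
  tuples fill the last \<open>n\<close> coordinates from the right end leftwards.\<close>

lemma coord_append:
  assumes "lower_part m n (xs @ ys)" "p \<in> support (m + n) ys"
  shows "coord (m + n) (xs @ ys) p = coord (m + n) ys p"
  using assms
proof (induction xs)
  case (Cons x xs)
  have sub: "p \<in> label_set (xs @ ys) \<or> m + n - entries_sum (xs @ ys) < p"
    using Cons.prems(2) by (auto simp: support_def)
  from Cons.prems(1) have "lower_part m n (x # (xs @ ys))" by simp
  thus ?case
  proof (cases rule: lower_part_cases)
    case (tuple r)
    thus ?thesis using Cons sub lower_partD(1)[OF tuple(4)] by fastforce
  next
    case (cut b)
    have "p \<noteq> b" using cut Cons.prems(2) lower_partD(2)[OF cut(5)] by (auto simp: support_def)
    thus ?thesis using Cons cut by simp
  qed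
qed simp

lemma coord_ge_1:
  assumes "lower_part m n S" "p \<in> support (m + n) S"
  shows "1 \<le> coord (m + n) S p"
  using assms
proof (induction rule: lower_part_induct)
  case (tuple r S)
  thus ?case using coord_outside[OF tuple(3), of p] by (cases "p \<in> support (m+n) S") (auto simp: support_tuple)
next
  case (cut b S)
  thus ?case using coord_outside[OF cut(4), of p] by (cases "p \<in> support (m+n) S") (auto simp: support_cut)
qed simp

lemma coord_cut:
  assumes "lower_part m n (([], {b}) # S)"
  shows "coord (m + n) (([], {b}) # S) b = 1 + weight S"
  using assms
proof (cases rule: lower_part_cases)
  case (cut c)
  hence "b \<noteq> m + n - entries_sum S \<or> entries_sum S = n"
    using lower_partD(2)[OF cut(5)] by auto
  thus ?thesis using cut coord_outside[OF cut(5), of b] lower_partD(2)[OF cut(5)]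
    by (auto simp: support_def binomial_eq_0)
qed auto

lemma coord_tuple:
  assumes "lower_part m n (([r], {}) # S)" "m + n - (r + entries_sum S) < p" "p \<le> m + n - entries_sum S"
  shows "coord (m + n) (([r], {}) # S) p =
    1 + (if p = m + n - entries_sum S then real (r * weight S + (r choose 2)) else 0)"
  using assms(1)
proof (cases rule: lower_part_cases)
  case (tuple r')
  have "p \<notin> support (m + n) S"
    using assms(2,3) tuple lower_partD(1)[OF tuple(4)] by (auto simp: support_def)
  thus ?thesis using assms tuple coord_outside[OF tuple(4), of p] by simp
qed auto

lemma real_choose_2: "2 * real (k choose 2) = real k * (real k - 1)"
  by (induction k) (auto simp: numeral_2_eq_2 algebra_simps)

section \<open>Agreement of the recursive coordinates with the positional formula\<close>

lemma sum_nth_drop: "(\<Sum>j\<in>{k..<length S}. f (S ! j)) = sum_list (map f (drop k S))"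
proof (cases "k \<le> length S")
  case True
  have "sum_list (map f (drop k S)) = (\<Sum>i\<in>{0..<length S - k}. f (S ! (i + k)))"
    using True by (auto simp: sum_list_sum_nth add.commute intro!: sum.cong)
  also have "\<dots> = (\<Sum>j\<in>{0 + k..<length S - k + k}. f (S ! j))"
    by (rule sum.shift_bounds_nat_ivl[symmetric])
  finally show ?thesis using True by simp
qed simp

lemma entries_sum_drop: "(\<Sum>j\<in>{k..<length S}. sum_list (tuple_at S j)) = entries_sum (drop k S)"
proof -
  have "entries_sum T = sum_list (map (\<lambda>x. sum_list (fst x)) T)" for T by (induction T) auto
  thus ?thesis by (simp add: tuple_at_def sum_nth_drop[where f = "\<lambda>x. sum_list (fst x)"])
qed

lemma card_cuts_drop:
  assumes "\<forall>x\<in>set S. unary_entry x"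
  shows "card {j. k \<le> j \<and> j < length S \<and> labels_at S j \<noteq> {}} = num_labels (drop k S)"
proof -
  have card: "card (labels_at S j) = (if labels_at S j \<noteq> {} then 1 else 0)" if "j < length S" for j
  proof -
    have "unary_entry (S ! j)" using assms that by auto
    thus ?thesis by (auto simp: unary_entry_def labels_at_def)
  qed
  have "num_labels T = sum_list (map (\<lambda>x. card (snd x)) T)" for T by (induction T) auto
  hence "num_labels (drop k S) = (\<Sum>j\<in>{k..<length S}. card (labels_at S j))"
    by (simp add: labels_at_def sum_nth_drop[where f = "\<lambda>x. card (snd x)"])
  also have "\<dots> = (\<Sum>j\<in>{k..<length S}. if labels_at S j \<noteq> {} then 1 else 0)"
    using card by (intro sum.cong) auto
  also have "\<dots> = card ({k..<length S} \<inter> {j. labels_at S j \<noteq> {}})"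
    by (subst sum.If_cases) auto
  also have "{k..<length S} \<inter> {j. labels_at S j \<noteq> {}} = {j. k \<le> j \<and> j < length S \<and> labels_at S j \<noteq> {}}"
    by auto
  finally show ?thesis by simp
qed

lemma label_position:
  assumes "b \<in> label_set S" "\<forall>x\<in>set S. unary_entry x"
  obtains xs ys where "S = xs @ ([], {b}) # ys"
proof -
  have "b \<in> (\<Union>x\<in>set S. snd x)" using assms(1) by (induction S) auto
  then obtain x where x: "x \<in> set S" "b \<in> snd x" by blast
  hence "x = ([], {b})" using assms(2) by (auto simp: unary_entry_def)
  thus ?thesis using x(1) that by (auto dest: split_list)
qed

text \<open>All entries together sum to \<open>n\<close>, so the preceding sum, measured from the
  top, equals \<open>m + n\<close> minus the entries below. This turns the top-down formula into the
  bottom-up one.\<close>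

lemma tuple_position_at_sum_iff:
  assumes "S \<in> unary_shades m n"
  shows "tuple_position_at_sum m S p i \<longleftrightarrow>
    (\<exists>xs r ys. S = xs @ ([r], {}) # ys \<and> length xs = i \<and> p = m + n - entries_sum ys)"
proof
  assume L: "tuple_position_at_sum m S p i"
  hence i: "i < length S" "tuple_at S i \<noteq> []" by (auto simp: tuple_position_at_sum_def)
  have S: "S = take i S @ S ! i # drop (Suc i) S" using i(1) by (rule id_take_nth_drop)
  have "unary_entry (S ! i)" using assms i(1) by (auto simp: unary_shades_iff)
  then obtain r where r: "S ! i = ([r], {})" using i(2) by (auto simp: unary_entry_def tuple_at_def)
  have "p = m + (\<Sum>j<i. sum_list (tuple_at S j)) + r"
    using L r by (simp add: tuple_position_at_sum_def preceding_sum_def tuple_at_def)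
  also have "(\<Sum>j<i. sum_list (tuple_at S j)) = entries_sum (take i S)"
    using i(1) by (simp add: entries_sum_nth tuple_at_def min_def)
  finally have "p = m + entries_sum (take i S) + r" .
  moreover have "entries_sum (take i S) + (r + entries_sum (drop (Suc i) S)) = n"
    using assms arg_cong[OF S, of entries_sum] r by (simp add: unary_shades_iff)
  ultimately show "\<exists>xs r ys. S = xs @ ([r], {}) # ys \<and> length xs = i \<and> p = m + n - entries_sum ys"
    using S r i(1) by (intro exI[of _ "take i S"] exI[of _ r] exI[of _ "drop (Suc i) S"]) auto
next
  assume "\<exists>xs r ys. S = xs @ ([r], {}) # ys \<and> length xs = i \<and> p = m + n - entries_sum ys"
  then obtain xs r ys where S: "S = xs @ ([r], {}) # ys" "length xs = i" "p = m + n - entries_sum ys" by blast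
  have "(\<Sum>j<i. sum_list (tuple_at S j)) = entries_sum xs"
    using S by (auto simp: entries_sum_nth tuple_at_def nth_append intro!: sum.cong)
  moreover have "entries_sum xs + (r + entries_sum ys) = n" using assms S by (simp add: unary_shades_iff)
  ultimately show "tuple_position_at_sum m S p i"
    using S by (auto simp: tuple_position_at_sum_def preceding_sum_def tuple_at_def nth_append)
qed

text \<open>Of two distinct tuples, the lower one is positive and counted among the entries below
  the upper one, so the totals below them differ.\<close>

lemma tuple_position_unique:
  assumes S: "S \<in> unary_shades m n"
    and "S = xs @ ([r], {}) # ys" "S = xs' @ ([r'], {}) # ys'" "entries_sum ys = entries_sum ys'"
  shows "length xs = length xs'"
proof -
  have False if "S = xs @ ([r], {}) # ys" "S = xs' @ ([r'], {}) # ys'" "entries_sum ys = entries_sum ys'"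
    "length xs < length xs'" for xs xs' ys ys' r r'
  proof -
    from that(1,2,4) obtain zs where zs: "ys = zs @ ([r'], {}) # ys'"
      by (auto simp: append_eq_append_conv2 append_eq_Cons_conv)
    have "1 \<le> r'" using S that(2) by (auto simp: unary_shades_iff unary_entry_def)
    thus False using zs that(3) by simp
  qed
  from this[OF assms(2-4)] this[OF assms(3,2) assms(4)[symmetric]] show ?thesis
    by (meson linorder_neqE_nat)
qed

text \<open>Such a coordinate lies in the block of some tuple but is not its last one, so it carries
  no excess over 1.\<close>

lemma coord_not_tuple_end:
  assumes "lower_part m n S" "p \<in> support (m + n) S" "m < p"
    and "\<And>xs r ys. S = xs @ ([r], {}) # ys \<Longrightarrow> p \<noteq> m + n - entries_sum ys"
  shows "coord (m + n) S p = 1"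
  using assms
proof (induction rule: lower_part_induct)
  case (tuple r S)
  have rM: "r + entries_sum S \<le> m + n" using tuple by simp
  show ?case
  proof (cases "p \<in> support (m + n) S")
    case True
    have "coord (m + n) S p = 1"
      using tuple.IH True tuple.prems(2) tuple.prems(3)[of "([r], {}) # _"] by auto
    thus ?thesis using coord_append[of m n "[([r], {})]" S p] tuple(4) True by simp
  next
    case False
    thus ?thesis using tuple.prems(1) tuple.prems(3)[of "[]"] rM
      by (subst coord_tuple[OF tuple(4)]) (auto simp: support_tuple)
  qed
next
  case (cut b S)
  have p: "p \<in> support (m + n) S" using cut by (auto simp: support_cut)
  have "coord (m + n) S p = 1"
    using cut.IH p cut.prems(2) cut.prems(3)[of "([], {b}) # _"] by auto
  thus ?case using coord_append[of m n "[([], {b})]" S p] cut(5) p by simp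
qed simp

lemma hoch_coord_eq:
  assumes S: "S \<in> unary_shades m n" and p: "1 \<le> p" "p \<le> m + n"
  shows "hoch_coord m n S p = coord (m + n) S p"
proof -
  have entries: "\<forall>x\<in>set S. unary_entry x" and labels: "label_set S = {1..m}"
    using S by (auto simp: unary_shades_iff)
  note low = unary_shades_lower_part[OF S]
  show ?thesis
  proof (cases "p \<le> m")
    case True
    have "p \<in> label_set S" using labels True p by simp
    then obtain xs ys where xs: "S = xs @ ([], {p}) # ys" using entries by (rule label_position)
    have disj: "disjoint_family_on (labels_at S) {..<length S}"
      using S by (auto simp: unary_shades_def shades_def)
    have at: "length xs < length S" "p \<in> labels_at S (length xs)" using xs by (auto simp: labels_at_def)
    have "cut_position S p = length xs"
      unfolding cut_position_def
    proof (rule the_equality)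
      fix i assume "i < length S \<and> p \<in> labels_at S i"
      thus "i = length xs" using disj at by (auto simp: disjoint_family_on_def)
    qed (use at in auto)
    moreover have "cuts_weakly_below S (length xs) = 1 + num_labels ys"
      unfolding cuts_weakly_below_def by (subst card_cuts_drop[OF entries]) (simp add: xs)
    moreover have "entries_below S (length xs) = entries_sum (drop (Suc (length xs)) S)"
      by (simp add: entries_below_def flip: entries_sum_drop atLeastSucLessThan_greaterThanLessThan)
    moreover have "drop (Suc (length xs)) S = ys" by (simp add: xs)
    ultimately have "hoch_coord m n S p = 1 + weight ys"
      using True by (simp add: hoch_coord_def weight_def)
    also have "\<dots> = coord (m + n) (([], {p}) # ys) p"
      using coord_cut lower_part_suffix low xs by metis
    also have "\<dots> = coord (m + n) S p"
      using coord_append[of m n xs "([], {p}) # ys" p] low xs by (simp add: support_cut del: coord.simps)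
    finally show ?thesis .
  next
    case False
    show ?thesis
    proof (cases "\<exists>i. tuple_position_at_sum m S p i")
      case True
      then obtain xs r ys where xs: "S = xs @ ([r], {}) # ys" and p_eq: "p = m + n - entries_sum ys"
        unfolding tuple_position_at_sum_iff[OF S] by blast
      have sum: "entries_sum xs + (r + entries_sum ys) = n" and r: "1 \<le> r"
        using S xs by (auto simp: unary_shades_iff unary_entry_def)
      have "tuple_position m S p = length xs"
        unfolding tuple_position_def
      proof (rule the_equality)
        show "tuple_position_at_sum m S p (length xs)"
          unfolding tuple_position_at_sum_iff[OF S] using xs p_eq by blast
        fix i assume "tuple_position_at_sum m S p i"
        then obtain xs' r' ys' where xs': "S = xs' @ ([r'], {}) # ys'" "length xs' = i" "p = m + n - entries_sum ys'"
          unfolding tuple_position_at_sum_iff[OF S] by blast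
        have "entries_sum ys' \<le> n" using S xs'(1) by (auto simp: unary_shades_iff)
        hence "entries_sum ys' = entries_sum ys" using sum p_eq xs'(3) by simp
        thus "i = length xs" using tuple_position_unique[OF S xs'(1) xs] xs'(2) by simp
      qed
      moreover have "hd (tuple_at S (length xs)) = r" by (simp add: xs tuple_at_def)
      moreover have "cuts_below S (length xs) = num_labels ys"
        unfolding cuts_below_def using card_cuts_drop[OF entries, of "Suc (length xs)"] xs
        by (simp add: Suc_le_eq)
      moreover have "real (m + n) - real p = entries_sum ys" using p_eq sum by simp
      ultimately have "hoch_coord m n S p = 1 + real (r * weight ys + (r choose 2))"
        using False True by (simp add: hoch_coord_def weight_def)
      also have "\<dots> = coord (m + n) (([r], {}) # ys) p"
      proof -
        have "lower_part m n (([r], {}) # ys)" using lower_part_suffix low xs by metis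
        from coord_tuple[OF this, of p] show ?thesis using p_eq r sum by simp
      qed
      also have "\<dots> = coord (m + n) S p"
      proof -
        have "p \<in> support (m + n) (([r], {}) # ys)" using p_eq r sum by (auto simp: support_def)
        thus ?thesis using coord_append[of m n xs "([r], {}) # ys" p] low xs by simp
      qed
      finally show ?thesis .
    next
      case no_end: False
      hence "p \<noteq> m + n - entries_sum ys" if "S = xs @ ([r], {}) # ys" for xs r ys
        unfolding tuple_position_at_sum_iff[OF S] using that by blast
      hence "coord (m + n) S p = 1"
        using False p support_unary_shade[OF S] by (intro coord_not_tuple_end[OF low]) auto
      thus ?thesis unfolding hoch_coord_def if_not_P[OF False] if_not_P[OF no_end] by simp
    qed
  qed
qed

section \<open>Facets\<close>

text \<open>Let k count the coordinates of \<open>U\<close> filled so far. A cut in \<open>U\<close>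
  adds 1 + \<open>weight S\<close>, at least k + 1. A tuple of value \<open>r\<close> whose block
  meets \<open>U\<close> in j > 0 coordinates adds j + r \<open>weight S\<close> + r (r - 1) / 2,
  and j \<le> r, k \<le> \<open>weight S\<close> bound this below by (k+1) + ... + (k+j).
  Intersecting with the support makes the claim meaningful for lower parts.\<close>

lemma sum_coord_ge:
  assumes "lower_part m n S"
    and up: "\<And>p q. p \<in> U \<Longrightarrow> m < p \<Longrightarrow> p \<le> q \<Longrightarrow> q \<le> m + n \<Longrightarrow> q \<in> U"
  defines "M \<equiv> m + n"
  shows "real (card (U \<inter> support M S) * (card (U \<inter> support M S) + 1)) \<le>
    2 * (\<Sum>p\<in>U \<inter> support M S. coord M S p)"
  using assms(1)
proof (induction rule: lower_part_induct)
  case (cut b S)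
  let ?T = "U \<inter> support M S"
  let ?S' = "([], {b}) # S"
  have fin: "finite ?T" using finite_support[OF cut(4)] by simp
  note low = cut(5)
  have b: "b \<notin> support M S" using cut lower_partD(2)[OF cut(4)] by (auto simp: support_def M_def)
  have same: "(\<Sum>p\<in>?T. coord M ?S' p) = (\<Sum>p\<in>?T. coord M S p)"
    unfolding M_def using coord_append[of m n "[([], {b})]" S] low by (intro sum.cong) auto
  show ?case
  proof (cases "b \<in> U")
    case True
    have ins: "U \<inter> support M ?S' = insert b ?T" using True by (auto simp: support_cut)
    have "coord M ?S' b = 1 + weight S"
      unfolding M_def using low by (rule coord_cut)
    moreover have "real (card ?T) \<le> weight S"
      using card_mono[OF finite_support[OF cut(4)], of ?T M] card_support[OF cut(4)] by (simp add: M_def)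
    ultimately show ?thesis
      unfolding ins using fin b cut.IH same by (simp add: algebra_simps)
  next
    case False
    hence "U \<inter> support M ?S' = ?T" by (auto simp: support_cut)
    thus ?thesis using cut.IH same by simp
  qed
next
  case (tuple r S)
  let ?T = "U \<inter> support M S"
  let ?S' = "([r], {}) # S"
  let ?e = "M - entries_sum S"
  let ?B = "U \<inter> {?e - r<..?e}"
  have rM: "r + entries_sum S \<le> M" using tuple by (simp add: M_def)
  have e: "m < ?e" using tuple by (simp add: M_def)
  have fin: "finite ?T" using finite_support[OF tuple(3)] by simp
  note low = tuple(4)
  have disj: "?B \<inter> support M S = {}"
    using lower_partD(1,2)[OF tuple(3)] tuple(1,2) by (force simp: support_def M_def)
  have split: "U \<inter> support M ?S' = ?B \<union> ?T"
    using support_tuple[OF rM] by auto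
  have same: "(\<Sum>p\<in>?T. coord M ?S' p) = (\<Sum>p\<in>?T. coord M S p)"
    unfolding M_def using coord_append[of m n "[([r], {})]" S] low by (intro sum.cong) auto
  show ?case
  proof (cases "?B = {}")
    case True
    thus ?thesis using tuple.IH same split by simp
  next
    case False
    then obtain p where p: "p \<in> U" "?e - r < p" "p \<le> ?e" by auto
    have "m < p" using p tuple(2) by (simp add: M_def)
    \<comment> \<open>Upward closure puts the last coordinate of the block, which holds all the
      excess, into \<open>U\<close>; without it the block could contribute mere ones.\<close>
    hence "?e \<in> U" using up[of p ?e] p by (simp add: M_def)
    hence eB: "?e \<in> ?B" using tuple(1) e by auto
    have "(\<Sum>p\<in>?B. coord M ?S' p) = (\<Sum>p\<in>?B. 1 + (if p = ?e then real (r * weight S + (r choose 2)) else 0))"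
      using coord_tuple[OF low] by (intro sum.cong) (auto simp: M_def diff_diff_eq add.commute)
    also have "\<dots> = card ?B + (r * weight S + (r choose 2))"
      using eB by (subst sum.distrib) simp
    finally have sumB: "2 * (\<Sum>p\<in>?B. coord M ?S' p) = 2 * real (card ?B) + 2 * (real r * weight S) + real r * (real r - 1)"
      using real_choose_2[of r] by simp
    have "real (card ?T) \<le> weight S"
      using card_mono[OF finite_support[OF tuple(3)], of ?T M] card_support[OF tuple(3)] by (simp add: M_def)
    moreover have "card ?B \<le> r" using card_mono[of "{?e - r<..?e}" ?B] by auto
    ultimately have 1: "real (card ?B) * card ?T \<le> real r * weight S"
      by (intro mult_mono) auto
    have "1 \<le> card ?B" using eB card_gt_0_iff[of ?B] by (metis One_nat_def Suc_leI empty_iff finite_Int finite_greaterThanAtMost)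
    hence 2: "real (card ?B) * (real (card ?B) - 1) \<le> real r * (real r - 1)"
      using \<open>card ?B \<le> r\<close> by (intro mult_mono) auto
    have "card (?B \<union> ?T) = card ?B + card ?T" using fin disj by (intro card_Un_disjoint) auto
    moreover have "(\<Sum>p\<in>?B \<union> ?T. coord M ?S' p) = (\<Sum>p\<in>?B. coord M ?S' p) + (\<Sum>p\<in>?T. coord M S p)"
      using fin disj same by (subst sum.union_disjoint) auto
    ultimately show ?thesis
      unfolding split using tuple.IH sumB 1 2 by (simp add: algebra_simps)
  qed
qed simp

text \<open>The equality case of \<open>sum_coord_ge\<close>: an entry that raises the weight from w
  to w + r adds exactly (w+1) + ... + (w+r).\<close>

lemma sum_coord_support:
  assumes "lower_part m n S"
  defines "M \<equiv> m + n"
  shows "2 * (\<Sum>p\<in>support M S. coord M S p) = real (weight S * (weight S + 1))"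
  using assms(1)
proof (induction rule: lower_part_induct)
  case (cut b S)
  let ?S' = "([], {b}) # S"
  note low = cut(5)
  have b: "b \<notin> support M S" using cut lower_partD(2)[OF cut(4)] by (auto simp: support_def M_def)
  have same: "(\<Sum>p\<in>support M S. coord M ?S' p) = (\<Sum>p\<in>support M S. coord M S p)"
    unfolding M_def using coord_append[of m n "[([], {b})]" S] low by (intro sum.cong) auto
  have "coord M ?S' b = 1 + weight S"
    unfolding M_def using low by (rule coord_cut)
  thus ?case
    unfolding support_cut using finite_support[OF cut(4)] b cut.IH same by (simp add: algebra_simps)
next
  case (tuple r S)
  let ?S' = "([r], {}) # S"
  let ?e = "M - entries_sum S"
  let ?B = "{?e - r<..?e}"
  have rM: "r + entries_sum S \<le> M" using tuple by (simp add: M_def)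
  note low = tuple(4)
  have disj: "?B \<inter> support M S = {}"
    using lower_partD(1,2)[OF tuple(3)] tuple(1,2) by (force simp: support_def M_def)
  have same: "(\<Sum>p\<in>support M S. coord M ?S' p) = (\<Sum>p\<in>support M S. coord M S p)"
    unfolding M_def using coord_append[of m n "[([r], {})]" S] low by (intro sum.cong) auto
  have "(\<Sum>p\<in>?B. coord M ?S' p) = (\<Sum>p\<in>?B. 1 + (if p = ?e then real (r * weight S + (r choose 2)) else 0))"
    using coord_tuple[OF low] by (intro sum.cong) (auto simp: M_def diff_diff_eq add.commute)
  also have "\<dots> = r + (r * weight S + (r choose 2))"
    using rM tuple(1) by (subst sum.distrib) simp
  finally have sumB: "2 * (\<Sum>p\<in>?B. coord M ?S' p) = 2 * real r + 2 * (real r * weight S) + real r * (real r - 1)"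
    using real_choose_2[of r] by simp
  have "(\<Sum>p\<in>?B \<union> support M S. coord M ?S' p) = (\<Sum>p\<in>?B. coord M ?S' p) + (\<Sum>p\<in>support M S. coord M S p)"
    using finite_support[OF tuple(3)] disj same by (subst sum.union_disjoint) auto
  thus ?case
    unfolding support_tuple[OF rM] using tuple.IH sumB by (simp add: algebra_simps)
qed simp

text \<open>The coordinate sets of the facets through the point of a shade: the supports of the proper
  lower parts, where the bound of \<open>sum_coord_ge\<close> is attained, and the coordinates equal
  to 1 in the interior of a tuple.\<close>

primrec facet_sets :: "nat \<Rightarrow> shade \<Rightarrow> nat set set" where
  "facet_sets M [] = {}"
| "facet_sets M (x # S) = (if S = [] then {} else {support M S})
     \<union> {{p} | p. M - entries_sum (x # S) < p \<and> p < M - entries_sum S} \<union> facet_sets M S"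

lemma facet_sets_cases:
  assumes "U \<in> facet_sets M S"
  obtains (lower) xs x y ys where "S = xs @ x # y # ys" "U = support M (y # ys)"
  | (interior) xs x ys p where "S = xs @ x # ys" "M - entries_sum (x # ys) < p"
      "p < M - entries_sum ys" "U = {p}"
proof -
  have "(\<exists>xs x y ys. S = xs @ x # y # ys \<and> U = support M (y # ys)) \<or>
    (\<exists>xs x ys p. S = xs @ x # ys \<and> M - entries_sum (x # ys) < p \<and> p < M - entries_sum ys \<and> U = {p})"
    using assms
  proof (induction S)
    case (Cons x S)
    from Cons.prems consider "S \<noteq> []" "U = support M S"
      | p where "U = {p}" "M - entries_sum (x # S) < p" "p < M - entries_sum S"
      | "U \<in> facet_sets M S" by (auto split: if_splits)
    thus ?case
    proof cases
      case 1
      thus ?thesis by (metis append_Nil neq_Nil_conv)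
    next
      case 2
      thus ?thesis by (metis append_Nil)
    next
      case 3
      thus ?thesis using Cons.IH by (metis append_Cons)
    qed
  qed simp
  thus ?thesis using that by blast
qed

lemma finite_facet_sets: "finite (facet_sets M S)"
proof (induction S)
  case (Cons x S)
  have "{{p} | p. M - entries_sum (x # S) < p \<and> p < M - entries_sum S} =
      (\<lambda>p. {p}) ` {M - entries_sum (x # S)<..<M - entries_sum S}" by auto
  thus ?case using Cons by simp
qed simp

lemma facet_sets_subset:
  assumes "U \<in> facet_sets (m + n) S" "lower_part m n S"
  shows "U \<subseteq> support (m + n) S"
  using assms(1)
proof (cases rule: facet_sets_cases)
  case (lower xs x y ys)
  thus ?thesis by (auto simp: support_def)
next
  case (interior xs x ys p)
  thus ?thesis by (auto simp: support_def)
qed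

text \<open>Both kinds of facet sets fit one formula: an interior coordinate has value 1, which is
  the bound for a set of size 1.\<close>

lemma sum_coord_facet_set:
  assumes S: "lower_part m n S" and U: "U \<in> facet_sets (m + n) S"
  shows "2 * (\<Sum>p\<in>U. coord (m + n) S p) = real (card U * (card U + 1))"
  using U
proof (cases rule: facet_sets_cases)
  case (lower xs x y ys)
  have S': "lower_part m n ((xs @ [x]) @ y # ys)" using S lower by simp
  hence low: "lower_part m n (y # ys)" by (rule lower_part_suffix)
  have "(\<Sum>p\<in>U. coord (m + n) S p) = (\<Sum>p\<in>U. coord (m + n) (y # ys) p)"
    unfolding lower using coord_append[OF S'] by (intro sum.cong) auto
  thus ?thesis using sum_coord_support[OF low] card_support[OF low] lower by simp
next
  case (interior xs x ys p)
  have S': "lower_part m n (xs @ x # ys)" using S interior by simp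
  hence low: "lower_part m n (x # ys)" by (rule lower_part_suffix)
  have "p \<in> support (m + n) (x # ys)" using interior by (auto simp: support_def)
  hence "coord (m + n) S p = coord (m + n) (x # ys) p"
    unfolding interior using coord_append[OF S'] by simp
  also from low have "\<dots> = 1"
  proof (cases rule: lower_part_cases)
    case (tuple r)
    have "m < p" using interior tuple by simp
    hence "p \<notin> support (m + n) ys"
      using interior lower_partD(1)[OF tuple(4)] by (auto simp: support_def)
    hence "coord (m + n) ys p = 0" using coord_outside[OF tuple(4)] \<open>m < p\<close> by simp
    thus ?thesis using interior tuple by simp
  qed (use interior in auto)
  finally show ?thesis using interior by simp
qed

text \<open>The support of a lower part is a set of labels together with an interval ending at
  \<open>m + n\<close>, hence meets the closure hypothesis of \<open>sum_coord_ge\<close>. Interior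
  singletons need not, and rest on \<open>coord_ge_1\<close>.\<close>

lemma sum_coord_facet_set_le:
  assumes S: "S \<in> unary_shades m n" and U: "U \<in> facet_sets (m + n) S"
    and T: "T \<in> unary_shades m n"
  shows "(\<Sum>p\<in>U. coord (m + n) S p) \<le> (\<Sum>p\<in>U. coord (m + n) T p)"
proof -
  note low = unary_shades_lower_part[OF S] unary_shades_lower_part[OF T]
  have "U \<subseteq> support (m + n) S" by (rule facet_sets_subset[OF U low(1)])
  hence sub: "U \<subseteq> support (m + n) T" using S T by (simp add: support_unary_shade)
  have "real (card U * (card U + 1)) \<le> 2 * (\<Sum>p\<in>U. coord (m + n) T p)"
    using U
  proof (cases rule: facet_sets_cases)
    case (lower xs x y ys)
    have "lower_part m n ((xs @ [x]) @ y # ys)" using low(1) lower by simp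
    hence "lower_part m n (y # ys)" by (rule lower_part_suffix)
    hence "p \<in> U \<Longrightarrow> m < p \<Longrightarrow> p \<le> q \<Longrightarrow> q \<le> m + n \<Longrightarrow> q \<in> U" for p q
      using lower_partD(1)[of m n "y # ys"] unfolding lower support_def by fastforce
    thus ?thesis using sum_coord_ge[OF low(2), of U] sub by (simp add: Int_absorb2)
  next
    case (interior xs x ys p)
    thus ?thesis using coord_ge_1[OF low(2), of p] sub by simp
  qed
  thus ?thesis using sum_coord_facet_set[OF low(1) U] by simp
qed

text \<open>Sums over consecutive supports differ by the block of one entry. All coordinates of the
  block except the last are facet sets themselves, so the last one vanishes too. The sum over the
  whole support, which is not a facet set, is supplied by the constant total of all
  coordinates.\<close>

lemma facet_sets_separating:
  fixes y :: "nat \<Rightarrow> real"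
  assumes "lower_part m n S" "\<And>U. U \<in> facet_sets (m + n) S \<Longrightarrow> sum y U = 0"
    and "sum y (support (m + n) S) = 0" "p \<in> support (m + n) S"
  shows "y p = 0"
  using assms
proof (induction arbitrary: p rule: lower_part_induct)
  case (cut b S)
  have "sum y (support (m + n) S) = 0"
    using cut.prems(1)[of "support (m + n) S"] by (cases "S = []") auto
  moreover have "sum y U = 0" if "U \<in> facet_sets (m + n) S" for U
    using that by (intro cut.prems(1)) simp
  ultimately have IH: "y q = 0" if "q \<in> support (m + n) S" for q
    using cut.IH[OF _ _ that] by blast
  have "b \<notin> support (m + n) S" using cut(2,3) lower_partD(2)[OF cut(4)] by (auto simp: support_def)
  hence "y b = 0"
    using cut.prems(2) IH finite_support[OF cut(4)] by (simp add: support_cut)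
  thus ?case using IH cut.prems(3) by (auto simp: support_cut)
next
  case (tuple r S)
  have rM: "r + entries_sum S \<le> m + n" using tuple by simp
  let ?e = "m + n - entries_sum S"
  have "sum y (support (m + n) S) = 0"
    using tuple.prems(1)[of "support (m + n) S"] by (cases "S = []") auto
  moreover have "sum y U = 0" if "U \<in> facet_sets (m + n) S" for U
    using that by (intro tuple.prems(1)) simp
  ultimately have IH: "y q = 0" if "q \<in> support (m + n) S" for q
    using tuple.IH[OF _ _ that] by blast
  have interior: "y q = 0" if "?e - r < q" "q < ?e" for q
    using tuple.prems(1)[of "{q}"] that by (auto simp: diff_diff_eq add.commute)
  have zero: "y q = 0" if "q \<in> support (m + n) (([r], {}) # S)" "q \<noteq> ?e" for q
    using that IH interior[of q] by (auto simp: support_tuple[OF rM])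
  have "sum y (support (m + n) (([r], {}) # S)) = sum y {?e}"
    using zero tuple(1,2) finite_support[OF tuple(3)]
    by (intro sum.mono_neutral_right) (auto simp: support_tuple[OF rM])
  hence "y ?e = 0" using tuple.prems(2) by simp
  thus ?case using zero tuple.prems(3) by (cases "p = ?e") auto
qed simp

section \<open>Recovering a shade from its point\<close>

text \<open>Serves to detect a cut on top: its label has the full weight as coordinate, whereas a
  label further down is bounded by the smaller weight of the tail.\<close>

lemma coord_label_le:
  assumes "lower_part m n S" "b \<in> label_set S"
  shows "coord (m + n) S b \<le> weight S"
  using assms
proof (induction rule: lower_part_induct)
  case (tuple r S)
  thus ?case using lower_partD(1,2)[OF tuple(3)] by fastforce
next
  case (cut c S)
  have "coord (m + n) S c = 0"
    using cut lower_partD(2)[OF cut(4)] by (intro coord_outside) (auto simp: support_def)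
  moreover have "b \<le> m" using cut.prems cut(2) lower_partD(1)[OF cut(4)] by auto
  moreover have "m < m + n - entries_sum S \<or> n = entries_sum S"
    using lower_partD(2)[OF cut(4)] by auto
  ultimately show ?case using cut by (auto simp: binomial_eq_0)
qed simp

text \<open>Both blocks start at the same coordinate. If \<open>s\<close> were larger, the end of
  the block of \<open>r\<close> would be interior to that of \<open>s\<close> and have value 1. Then
  nothing lies below \<open>r\<close>, but equal totals leave \<open>s - r\<close> or more
  there.\<close>

lemma tuple_value_le:
  assumes "lower_part m n (([r], {}) # S)" "lower_part m n (([s], {}) # T)"
    "r + entries_sum S = s + entries_sum T"
    and eq: "coord (m + n) (([r], {}) # S) (m + n - entries_sum S) =
      coord (m + n) (([s], {}) # T) (m + n - entries_sum S)"
  shows "s \<le> r"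
proof (rule ccontr)
  assume "\<not> s \<le> r"
  have r: "1 \<le> r" "r + entries_sum S \<le> n" "s + entries_sum T \<le> n"
    using assms(1,2) by (auto elim!: lower_part_cases)
  have "coord (m + n) (([s], {}) # T) (m + n - entries_sum S) = 1"
    using \<open>\<not> s \<le> r\<close> r assms(3) by (subst coord_tuple[OF assms(2)]) auto
  moreover have "coord (m + n) (([r], {}) # S) (m + n - entries_sum S) =
      1 + real (r * weight S + (r choose 2))"
    using r by (subst coord_tuple[OF assms(1)]) auto
  ultimately have "real (r * weight S + (r choose 2)) = 0" using eq by linarith
  hence "r * weight S = 0" unfolding of_nat_eq_0_iff by simp
  moreover have "0 < entries_sum S" using \<open>\<not> s \<le> r\<close> assms(3) by simp
  ultimately show False using r by (simp add: weight_def)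
qed

text \<open>The shade is read off from the top. A top cut is recognised by its label having the
  total weight as coordinate; otherwise \<open>tuple_value_le\<close>, used both ways, gives the
  value of the top tuple. The tails then have equal supports again.\<close>

lemma coord_inj:
  assumes "lower_part m n S" "lower_part m n T" "label_set S = label_set T"
    "entries_sum S = entries_sum T"
    "\<And>p. p \<in> support (m + n) S \<Longrightarrow> coord (m + n) S p = coord (m + n) T p"
  shows "S = T"
  using assms
proof (induction arbitrary: T rule: lower_part_induct)
  case Nil
  thus ?case by (cases T) (auto elim: lower_part_cases)
next
  case (tuple r S)
  note S = tuple(1-4) and S_prems = tuple.prems and S_IH = tuple.IH
  let ?S = "([r], {}) # S"
  have wT: "weight T = weight ?S"
    using lower_partD(4)[OF tuple(4)] lower_partD(4)[OF tuple.prems(1)] tuple.prems(2,3)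
    by (simp add: weight_def)
  obtain t T' where T: "T = t # T'" using tuple(1) tuple.prems(3) by (cases T) auto
  have supp: "support (m + n) ?S = support (m + n) T" using tuple.prems(2,3) by (simp add: support_def)
  from tuple.prems(1)[unfolded T] show ?case
  proof (cases rule: lower_part_cases)
    case (tuple s)
    have low: "lower_part m n (([s], {}) # T')" using S_prems(1) T tuple by simp
    have sum: "r + entries_sum S = s + entries_sum T'" using S_prems(3) T tuple by simp
    have ends: "m + n - entries_sum S \<in> support (m + n) ?S" "m + n - entries_sum T' \<in> support (m + n) ?S"
      using S(1,2) tuple(2,3) sum by (auto simp: support_def)
    note eq = S_prems(4)[unfolded T tuple(1)]
    have "s = r"
      using tuple_value_le[OF S(4) low sum eq[OF ends(1)]]
        tuple_value_le[OF low S(4) sum[symmetric] eq[OF ends(2), symmetric]]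
      by (rule order_antisym)
    moreover have "S = T'"
    proof (rule S_IH)
      show "label_set S = label_set T'" "entries_sum S = entries_sum T'"
        using S_prems(2) sum T tuple(1) \<open>s = r\<close> by auto
      hence supp': "support (m + n) S = support (m + n) T'" by (simp add: support_def)
      fix p assume p: "p \<in> support (m + n) S"
      have "p \<in> support (m + n) ?S" using p by (auto simp: support_def)
      hence "coord (m + n) ?S p = coord (m + n) (([s], {}) # T') p" using S_prems(4) T tuple(1) by simp
      thus "coord (m + n) S p = coord (m + n) T' p"
        using p supp' coord_append[of m n "[([r], {})]" S p] coord_append[of m n "[([s], {})]" T' p] S(4) low
        by simp
    qed (use tuple in auto)
    ultimately show ?thesis using T tuple(1) by simp
  next
    case (cut b)
    have b: "b \<in> label_set ?S" using S_prems(2) T cut(1) by auto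
    \<comment> \<open>A top cut of \<open>T\<close> would give its label a value too large for a
      label lying below the tuple in \<open>?S\<close>.\<close>
    have "real (weight ?S) = coord (m + n) T b"
      using coord_cut[of m n b T'] S_prems(1) T cut(1) wT by simp
    also have "\<dots> = coord (m + n) ?S b" using S_prems(4) b by (simp add: support_def)
    also have "\<dots> = coord (m + n) S b"
      using coord_append[of m n "[([r], {})]" S b] S(4) b by (simp add: support_def)
    also have "\<dots> \<le> weight S" using coord_label_le[OF S(3)] b by simp
    finally show ?thesis using S(1) by simp
  qed
next
  case (cut b S)
  note S = cut(1-5) and S_prems = cut.prems and S_IH = cut.IH
  let ?S = "([], {b}) # S"
  have wT: "weight T = weight ?S"
    using lower_partD(4)[OF cut(5)] lower_partD(4)[OF cut.prems(1)] cut.prems(2,3)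
    by (simp add: weight_def)
  have bT: "b \<in> label_set T" using cut.prems(2) by auto
  obtain t T' where T: "T = t # T'" using bT by (cases T) auto
  have b: "coord (m + n) T b = real (weight T)"
    using cut.prems(4)[of b] coord_cut[OF S(5)] wT by (simp add: support_def)
  from cut.prems(1)[unfolded T] show ?case
  proof (cases rule: lower_part_cases)
    case (tuple s)
    have "coord (m + n) T b = coord (m + n) T' b"
      using coord_append[of m n "[([s], {})]" T' b] S_prems(1) T tuple(1) bT by (simp add: support_def)
    also have "\<dots> \<le> weight T'" using coord_label_le[OF tuple(4)] bT T tuple(1) by simp
    finally show ?thesis using b T tuple(1,2) by simp
  next
    case (cut c)
    have low: "lower_part m n (([], {c}) # T')" using S_prems(1) T cut(1) by simp
    have "c = b"
    proof (rule ccontr)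
      assume "c \<noteq> b"
      hence "b \<in> label_set T'" using bT T cut(1) by auto
      hence "coord (m + n) T b \<le> weight T'"
        using coord_append[of m n "[([], {c})]" T' b] coord_label_le[OF cut(5)] low T cut(1)
        by (simp add: support_def del: coord.simps)
      thus False using b T cut(1) by simp
    qed
    moreover have "S = T'"
    proof (rule S_IH)
      show "label_set S = label_set T'" "entries_sum S = entries_sum T'"
        using S_prems(2,3) T cut(1,4) S(3) \<open>c = b\<close> by auto
      hence supp': "support (m + n) S = support (m + n) T'" by (simp add: support_def)
      fix p assume p: "p \<in> support (m + n) S"
      have "p \<in> support (m + n) ?S" using p by (auto simp: support_def)
      hence "coord (m + n) ?S p = coord (m + n) (([], {c}) # T') p" using S_prems(4) T cut(1) by simp
      thus "coord (m + n) S p = coord (m + n) T' p"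
        using p supp' coord_append[of m n "[([], {b})]" S p] coord_append[of m n "[([], {c})]" T' p] S(5) low
        by simp
    qed (use cut in auto)
    ultimately show ?thesis using T cut(1) by simp
  qed
qed

section \<open>Rotations\<close>

text \<open>Entries above see the part below only through its support, its entry sum and its being
  nonempty, so a local change affects only the facet sets made locally.\<close>

lemma facet_sets_append_mono:
  assumes "label_set S = label_set T" "entries_sum S = entries_sum T" "S \<noteq> []" "T \<noteq> []"
    and "facet_sets M S \<subseteq> insert U (facet_sets M T)"
  shows "facet_sets M (xs @ S) \<subseteq> insert U (facet_sets M (xs @ T))"
proof (induction xs)
  case (Cons x xs)
  have "support M (xs @ S) = support M (xs @ T)" "entries_sum (xs @ S) = entries_sum (xs @ T)"
    using assms by (auto simp: support_def)
  thus ?case using Cons assms(3,4) by auto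
qed (use assms in auto)

text \<open>If one of the two entries has an empty tuple, the swap leaves all tuple blocks in place,
  and only the support ending between the two entries can be lost.\<close>

lemma facet_sets_swap:
  assumes "fst x = [] \<or> fst y = []"
  shows "facet_sets M (xs @ [x, y] @ ys) \<subseteq> insert (support M (y # ys)) (facet_sets M (xs @ [y, x] @ ys))"
proof (rule facet_sets_append_mono)
  show "facet_sets M ([x, y] @ ys) \<subseteq> insert (support M (y # ys)) (facet_sets M ([y, x] @ ys))"
    using assms by (elim disjE) (auto split: if_splits)
qed auto

lemma facet_sets_merge:
  "facet_sets M (xs @ [([s], {}), ([t], {})] @ ys) \<subseteq>
    insert (support M (([t], {}) # ys)) (facet_sets M (xs @ [([s + t], {})] @ ys))"
  by (rule facet_sets_append_mono) auto

text \<open>The lost singleton is the coordinate where the block of the upper piece now ends; it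
  ceases to be interior.\<close>

lemma facet_sets_split:
  "facet_sets M (xs @ [([s + t], {})] @ ys) \<subseteq>
    insert {M - entries_sum (([t], {}) # ys)} (facet_sets M (xs @ [([s], {}), ([t], {})] @ ys))"
  by (rule facet_sets_append_mono) auto

lemma facet_sets_suffix: "facet_sets M ys \<subseteq> facet_sets M (xs @ ys)"
  by (induction xs) auto

definition rotation_adj :: "shade \<Rightarrow> shade \<Rightarrow> bool" where
  "rotation_adj S T \<longleftrightarrow> right_rotation S T \<or> right_rotation T S"

lemma facet_sets_right_rotation:
  assumes "right_rotation S T" "S \<in> unary_shades m n"
  shows "\<exists>U\<in>facet_sets (m + n) S. facet_sets (m + n) S \<subseteq> insert U (facet_sets (m + n) T)"
    and "\<exists>U\<in>facet_sets (m + n) T. facet_sets (m + n) T \<subseteq> insert U (facet_sets (m + n) S)"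
proof -
  have lower: "support (m + n) (y # ys) \<in> facet_sets (m + n) (xs @ [x, y] @ ys)" for xs x y ys
    using facet_sets_suffix[of "m + n" "[x, y] @ ys" xs] by auto
  have "(\<exists>U\<in>facet_sets (m + n) S. facet_sets (m + n) S \<subseteq> insert U (facet_sets (m + n) T)) \<and>
    (\<exists>U\<in>facet_sets (m + n) T. facet_sets (m + n) T \<subseteq> insert U (facet_sets (m + n) S))"
    using assms
  proof (induction rule: right_rotation.induct)
    case (split_tuple s t r xs ys)
    have "entries_sum (xs @ [([s + t], {})] @ ys) = n"
      using split_tuple by (auto simp: unary_shades_iff)
    hence "{m + n - entries_sum (([t], {}) # ys)} \<in> facet_sets (m + n) (([s + t], {}) # ys)"
      using split_tuple(1,2) by auto
    hence middle: "{m + n - entries_sum (([t], {}) # ys)} \<in> facet_sets (m + n) (xs @ [([s + t], {})] @ ys)"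
      using facet_sets_suffix[of "m + n" "([s + t], {}) # ys" xs] by auto
    show ?case unfolding \<open>r = s + t\<close>
      by (intro conjI) (rule bexI, rule facet_sets_split, rule middle, rule bexI, rule facet_sets_merge, rule lower)
  next
    case (raise_cut xs r b ys)
    show ?case
      by (intro conjI) (rule bexI, rule facet_sets_swap, simp, rule lower)+
  next
    case (swap_cuts a b xs ys)
    show ?case
      by (intro conjI) (rule bexI, rule facet_sets_swap, simp, rule lower)+
  qed
  thus "\<exists>U\<in>facet_sets (m + n) S. facet_sets (m + n) S \<subseteq> insert U (facet_sets (m + n) T)"
    "\<exists>U\<in>facet_sets (m + n) T. facet_sets (m + n) T \<subseteq> insert U (facet_sets (m + n) S)" by auto
qed

text \<open>The facet set prescribes the rotation: the boundary of a lower part is removed by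
  swapping the two entries around it, or by merging them if both are tuples; an interior coordinate
  is removed by splitting its tuple there.\<close>

lemma facet_sets_neighbour:
  assumes S: "S \<in> unary_shades m n" and U: "U \<in> facet_sets (m + n) S"
  shows "\<exists>T\<in>unary_shades m n. rotation_adj S T \<and> facet_sets (m + n) S \<subseteq> insert U (facet_sets (m + n) T)"
  using U
proof (cases rule: facet_sets_cases)
  case (lower xs x y ys)
  have SS: "S = xs @ [x, y] @ ys" using lower by simp
  have entries: "unary_entry x" "unary_entry y" using S lower by (auto simp: unary_shades_iff)
  have low: "lower_part m n (x # y # ys)"
    using lower_part_suffix[of m n xs] unary_shades_lower_part[OF S] lower by simp
  show ?thesis
  proof (cases "fst x = [] \<or> fst y = []")
    case True
    let ?T = "xs @ [y, x] @ ys"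
    have "?T \<in> unary_shades m n" using S SS by (auto simp: unary_shades_iff)
    moreover have "rotation_adj S ?T"
    proof -
      consider b r where "x = ([], {b})" "y = ([r], {})" | b r where "x = ([r], {})" "y = ([], {b})"
        | b c where "x = ([], {b})" "y = ([], {c})"
        using entries True by (auto simp: unary_entry_def)
      thus ?thesis
      proof cases
        case 3
        have "b \<noteq> c" using low 3 by (auto elim: lower_part_cases)
        hence "b < c \<or> c < b" by auto
        thus ?thesis unfolding SS rotation_adj_def 3 using swap_cuts by blast
      qed (use raise_cut in \<open>auto simp: SS rotation_adj_def\<close>)
    qed
    moreover have "facet_sets (m + n) S \<subseteq> insert U (facet_sets (m + n) ?T)"
      unfolding SS lower(2) using True by (rule facet_sets_swap)
    ultimately show ?thesis by blast
  next
    case False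
    then obtain s t where st: "x = ([s], {})" "y = ([t], {})" "1 \<le> s" "1 \<le> t"
      using entries by (auto simp: unary_entry_def)
    let ?T = "xs @ [([s + t], {})] @ ys"
    have "?T \<in> unary_shades m n" using S SS st by (auto simp: unary_shades_iff unary_entry_def)
    moreover have "rotation_adj S ?T"
      unfolding SS rotation_adj_def st(1,2) using split_tuple st(3,4) by blast
    moreover have "facet_sets (m + n) S \<subseteq> insert U (facet_sets (m + n) ?T)"
      unfolding SS lower(2) st(1,2) by (rule facet_sets_merge)
    ultimately show ?thesis by blast
  qed
next
  case (interior xs x ys p)
  have low: "lower_part m n (x # ys)"
    using lower_part_suffix[of m n xs] unary_shades_lower_part[OF S] interior by simp
  then obtain r where r: "x = ([r], {})" "r + entries_sum ys \<le> n"
    using interior by (cases rule: lower_part_cases) auto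
  \<comment> \<open>Chosen so that the block of the upper piece ends exactly at
    \<open>p\<close>.\<close>
  define t where "t = m + n - entries_sum ys - p"
  define s where "s = r - t"
  have st: "1 \<le> s" "1 \<le> t" "r = s + t" "p = m + n - entries_sum (([t], {}) # ys)"
    using interior r by (auto simp: s_def t_def)
  have SS: "S = xs @ [([s + t], {})] @ ys" using interior r st by simp
  let ?T = "xs @ [([s], {}), ([t], {})] @ ys"
  have "?T \<in> unary_shades m n" using S SS st by (auto simp: unary_shades_iff unary_entry_def)
  moreover have "rotation_adj S ?T"
    unfolding SS rotation_adj_def using split_tuple st by blast
  moreover have "facet_sets (m + n) S \<subseteq> insert U (facet_sets (m + n) ?T)"
    unfolding SS interior(4) st(4) by (rule facet_sets_split)
  ultimately show ?thesis by blast
qed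

section \<open>The displacement of a point under a rotation\<close>

lemma coord_append_diff:
  assumes "entries_sum S = entries_sum T" "num_labels S = num_labels T"
  shows "coord M (xs @ T) p - coord M (xs @ S) p = coord M T p - coord M S p"
proof (induction xs)
  case (Cons x xs)
  have "weight (xs @ S) = weight (xs @ T)" "entries_sum (xs @ S) = entries_sum (xs @ T)"
    using assms by (auto simp: weight_def)
  hence "coord M ((x # xs) @ T) p - coord M ((x # xs) @ S) p = coord M (xs @ T) p - coord M (xs @ S) p"
    by simp
  thus ?case using Cons by simp
qed simp

lemma choose_2_add: "(s + t) choose 2 = (s choose 2) + (t choose 2) + s * t"
proof -
  have "2 * real ((s + t) choose 2) = 2 * real ((s choose 2) + (t choose 2) + s * t)"
    by (simp add: real_choose_2 algebra_simps)
  hence "real ((s + t) choose 2) = real ((s choose 2) + (t choose 2) + s * t)" by simp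
  thus ?thesis unfolding of_nat_eq_iff .
qed

text \<open>An amount passes between two coordinates: the ends of the two pieces of a split tuple,
  the label and the end of the tuple for a raised cut, or the two labels of a swap. The receiver has
  the smaller index because labels precede tuple coordinates and the upper piece lies left of the
  lower one.\<close>

lemma coord_right_rotation:
  assumes "right_rotation S T" "S \<in> unary_shades m n"
  obtains i j D where "1 \<le> i" "i < j" "j \<le> m + n" "0 < D"
    "\<And>p. coord (m + n) T p = coord (m + n) S p + (if p = i then D else 0) - (if p = j then D else 0)"
proof -
  have "\<exists>i j D. 1 \<le> i \<and> i < j \<and> j \<le> m + n \<and> 0 < D \<and>
    (\<forall>p. coord (m + n) T p - coord (m + n) S p = (if p = i then D else 0) - (if p = j then D else 0))"
    using assms
  proof (induction rule: right_rotation.induct)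
    case (split_tuple s t r xs ys)
    let ?j = "m + n - entries_sum ys"
    \<comment> \<open>The excess of the upper piece, which has weight \<open>t + weight ys\<close>
      below it; by \<open>choose_2_add\<close> the end of the old block loses the same
      amount.\<close>
    let ?D = "real (s * (t + weight ys) + (s choose 2))"
    have "entries_sum (xs @ [([s + t], {})] @ ys) = n"
      using split_tuple by (auto simp: unary_shades_iff)
    hence le: "s + t + entries_sum ys \<le> n" by simp
    have "0 < s * (t + weight ys) + (s choose 2)" using split_tuple(1,2) by simp
    hence "0 < ?D" unfolding of_nat_0_less_iff .
    moreover have "coord (m + n) (xs @ [([s], {}), ([t], {})] @ ys) p - coord (m + n) (xs @ [([r], {})] @ ys) p =
      (if p = ?j - t then ?D else 0) - (if p = ?j then ?D else 0)" for p
      unfolding \<open>r = s + t\<close>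
      by (subst coord_append_diff) (use split_tuple(1,2) le in \<open>auto simp: choose_2_add algebra_simps\<close>)
    ultimately show ?case
      using le split_tuple(1,2) by (intro exI[of _ "?j - t"] exI[of _ ?j] exI[of _ ?D]) auto
  next
    case (raise_cut xs r b ys)
    let ?j = "m + n - entries_sum ys"
    have "label_set (xs @ [([r], {}), ([], {b})] @ ys) = {1..m}"
      using raise_cut by (simp add: unary_shades_iff)
    hence "b \<in> {1..m}" by auto
    hence b: "1 \<le> b" "b \<le> m" by auto
    have r: "1 \<le> r" and "entries_sum (xs @ [([r], {}), ([], {b})] @ ys) = n"
      using raise_cut by (auto simp: unary_shades_iff unary_entry_def)
    hence le: "r + entries_sum ys \<le> n" by simp
    \<comment> \<open>The cut gains the tuple now below it; the end of the tuple loses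
      \<open>r\<close> since the weight below it drops by one cut.\<close>
    have "coord (m + n) (xs @ [([], {b}), ([r], {})] @ ys) p - coord (m + n) (xs @ [([r], {}), ([], {b})] @ ys) p =
      (if p = b then real r else 0) - (if p = ?j then real r else 0)" for p
      by (subst coord_append_diff) (auto simp: algebra_simps binomial_eq_0)
    thus ?case using le b r by (intro exI[of _ b] exI[of _ ?j] exI[of _ "real r"]) auto
  next
    case (swap_cuts a b xs ys)
    have "label_set (xs @ [([], {b}), ([], {a})] @ ys) = {1..m}"
      using swap_cuts by (simp add: unary_shades_iff)
    hence "a \<in> {1..m}" "b \<in> {1..m}" by auto
    hence ab: "1 \<le> a" "b \<le> m" by auto
    have "coord (m + n) (xs @ [([], {a}), ([], {b})] @ ys) p - coord (m + n) (xs @ [([], {b}), ([], {a})] @ ys) p =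
      (if p = a then 1 else 0) - (if p = b then 1 else 0)" for p
      by (subst coord_append_diff) (auto simp: binomial_eq_0)
    thus ?case using ab swap_cuts(1) by (intro exI[of _ a] exI[of _ b] exI[of _ 1]) auto
  qed
  then obtain i j D where ij: "1 \<le> i" "i < j" "j \<le> m + n" "0 < D"
    and D: "\<And>p. coord (m + n) T p - coord (m + n) S p = (if p = i then D else 0) - (if p = j then D else 0)"
    by blast
  show ?thesis
  proof (rule that[OF ij])
    fix p
    show "coord (m + n) T p = coord (m + n) S p + (if p = i then D else 0) - (if p = j then D else 0)"
      using D[of p] by linarith
  qed
qed

section \<open>The skeleton of the Hochschild polytope\<close>

context
  fixes m n :: nat and e :: "nat \<Rightarrow> 'a::euclidean_space"
  assumes basis: "coord_basis (m + n) e"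
begin

lemma inner_coord_basis: "p \<in> {1..m + n} \<Longrightarrow> q \<in> {1..m + n} \<Longrightarrow> e p \<bullet> e q = (if p = q then 1 else 0)"
  using basis unfolding coord_basis_def
  by (metis (no_types, lifting) image_subset_iff inj_onD inner_Basis)

lemma inner_sum_coord_basis:
  assumes "U \<subseteq> {1..m + n}"
  shows "(\<Sum>p\<in>U. c p *\<^sub>R e p) \<bullet> (\<Sum>p=1..m + n. y p *\<^sub>R e p) = (\<Sum>p\<in>U. c p * y p)"
proof -
  have "e p \<bullet> (\<Sum>q=1..m + n. y q *\<^sub>R e q) = y p" if "p \<in> U" for p
  proof -
    have "e p \<bullet> (\<Sum>q=1..m + n. y q *\<^sub>R e q) = (\<Sum>q=1..m + n. if q = p then y p else 0)"
      unfolding inner_sum_right using assms that by (intro sum.cong) (auto simp: inner_coord_basis)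
    thus ?thesis using assms that by auto
  qed
  thus ?thesis by (simp add: inner_sum_left)
qed

lemma hoch_point_coord:
  "S \<in> unary_shades m n \<Longrightarrow> hoch_point e m n S = (\<Sum>p=1..m + n. coord (m + n) S p *\<^sub>R e p)"
  unfolding hoch_point_def by (intro sum.cong) (auto simp: hoch_coord_eq)

definition facet_normal :: "nat set \<Rightarrow> 'a" where
  "facet_normal U = (\<Sum>p\<in>U. e p)"

lemma inner_facet_normal:
  "U \<subseteq> {1..m + n} \<Longrightarrow> facet_normal U \<bullet> (\<Sum>p=1..m + n. y p *\<^sub>R e p) = sum y U"
  using inner_sum_coord_basis[of U "\<lambda>_. 1" y] by (simp add: facet_normal_def)

lemma facet_sets_subset_coords:
  "S \<in> unary_shades m n \<Longrightarrow> U \<in> facet_sets (m + n) S \<Longrightarrow> U \<subseteq> {1..m + n}"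
  using facet_sets_subset support_unary_shade unary_shades_lower_part by blast

lemma inner_facet_normal_hoch_point:
  assumes "S \<in> unary_shades m n" "T \<in> unary_shades m n" "U \<in> facet_sets (m + n) S"
  shows "facet_normal U \<bullet> hoch_point e m n T = (\<Sum>p\<in>U. coord (m + n) T p)"
  using inner_facet_normal[OF facet_sets_subset_coords[OF assms(1,3)]] hoch_point_coord[OF assms(2)] by simp

text \<open>The tight value depends only on \<open>card U\<close>, so it is the same at both
  points.\<close>

lemma inner_facet_normal_eq:
  assumes "S \<in> unary_shades m n" "T \<in> unary_shades m n"
    "U \<in> facet_sets (m + n) S" "U \<in> facet_sets (m + n) T"
  shows "facet_normal U \<bullet> hoch_point e m n T = facet_normal U \<bullet> hoch_point e m n S"
  using assms sum_coord_facet_set[OF unary_shades_lower_part] inner_facet_normal_hoch_point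
  by (smt (verit))

lemma inj_hoch_point: "inj_on (hoch_point e m n) (unary_shades m n)"
proof (rule inj_onI)
  fix S T assume S: "S \<in> unary_shades m n" and T: "T \<in> unary_shades m n"
    and eq: "hoch_point e m n S = hoch_point e m n T"
  have "coord (m + n) S p = coord (m + n) T p" if "p \<in> support (m + n) S" for p
  proof -
    have "{p} \<subseteq> {1..m + n}" using that S by (simp add: support_unary_shade)
    thus ?thesis using eq inner_facet_normal[of "{p}" "coord (m + n) S"] inner_facet_normal[of "{p}" "coord (m + n) T"]
      by (simp add: hoch_point_coord S T)
  qed
  thus "S = T" using coord_inj[OF S[THEN unary_shades_lower_part] T[THEN unary_shades_lower_part]] S T
    by (simp add: unary_shades_iff)
qed

lemma sum_coord_unary_shade:
  assumes "S \<in> unary_shades m n"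
  shows "2 * (\<Sum>p=1..m + n. coord (m + n) S p) = real ((m + n) * (m + n + 1))"
  using sum_coord_support[OF unary_shades_lower_part[OF assms]] assms
  by (simp add: support_unary_shade) (simp add: unary_shades_iff weight_def add.commute)

text \<open>The coefficient at \<open>p\<close> is \<open>m + n + 1 - 2 * p\<close>, so moving
  \<open>D\<close> from \<open>j\<close> to \<open>i\<close> raises the product by
  \<open>2 * (j - i) * D\<close>.\<close>

lemma omega_right_rotation:
  assumes "right_rotation S T" "S \<in> unary_shades m n" "T \<in> unary_shades m n"
  shows "omega_dir e (m + n) \<bullet> hoch_point e m n S < omega_dir e (m + n) \<bullet> hoch_point e m n T"
proof -
  obtain i j D where ij: "1 \<le> i" "i < j" "j \<le> m + n" "0 < D" and
    T: "\<And>p. coord (m + n) T p = coord (m + n) S p + (if p = i then D else 0) - (if p = j then D else 0)"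
    using coord_right_rotation[OF assms(1,2)] by blast
  define w where "w p = (real (m + n + 1) - real p) - real p" for p
  have inner: "omega_dir e (m + n) \<bullet> hoch_point e m n R = (\<Sum>p=1..m + n. w p * coord (m + n) R p)"
    if "R \<in> unary_shades m n" for R
    using inner_sum_coord_basis[OF order_refl] by (simp add: omega_dir_def hoch_point_coord that w_def)
  have "(\<Sum>p=1..m + n. w p * coord (m + n) T p) =
      (\<Sum>p=1..m + n. w p * coord (m + n) S p + (if p = i then w i * D else 0) - (if p = j then w j * D else 0))"
    unfolding T by (intro sum.cong) (auto simp: algebra_simps)
  also have "\<dots> = (\<Sum>p=1..m + n. w p * coord (m + n) S p) + w i * D - w j * D"
    using ij by (simp add: sum.distrib sum_subtractf)
  also have "\<dots> > (\<Sum>p=1..m + n. w p * coord (m + n) S p)"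
    using ij by (simp add: w_def)
  finally show ?thesis using inner assms by simp
qed

lemma rotation_adj_omega:
  assumes "rotation_adj S T" "S \<in> unary_shades m n" "T \<in> unary_shades m n"
  shows "omega_dir e (m + n) \<bullet> hoch_point e m n S < omega_dir e (m + n) \<bullet> hoch_point e m n T \<longleftrightarrow>
      right_rotation S T"
    and "omega_dir e (m + n) \<bullet> hoch_point e m n S \<noteq> omega_dir e (m + n) \<bullet> hoch_point e m n T"
  using assms omega_right_rotation[of S T] omega_right_rotation[of T S] by (auto simp: rotation_adj_def)

text \<open>The space \<open>?W\<close> is that of zero-sum vectors. It contains the differences
  because all points have the same coordinate total, and the vanishing sum is the full-support
  hypothesis of \<open>facet_sets_separating\<close>.\<close>

lemma simple_polytope_Hoch:
  "simple_polytope (unary_shades m n) (hoch_point e m n)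
     {\<Sum>p=1..m + n. y p *\<^sub>R e p | y. (\<Sum>p=1..m + n. y p) = 0}
     (\<lambda>S. facet_normal ` facet_sets (m + n) S) rotation_adj"
  (is "simple_polytope ?I ?a ?W ?C _")
proof
  show "finite ?I" by (rule finite_unary_shades)
  show "inj_on ?a ?I" by (rule inj_hoch_point)
  show "subspace ?W"
  proof (rule subspaceI)
    show "0 \<in> ?W" by (auto intro!: exI[of _ "\<lambda>_. 0"])
    fix x assume "x \<in> ?W"
    then obtain y where y: "x = (\<Sum>p=1..m + n. y p *\<^sub>R e p)" "(\<Sum>p=1..m + n. y p) = 0" by blast
    show "c *\<^sub>R x \<in> ?W" for c
      using y by (auto simp: scaleR_sum_right simp flip: sum_distrib_left intro!: exI[of _ "\<lambda>p. c * y p"])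
    fix x' assume "x' \<in> ?W"
    then obtain y' where "x' = (\<Sum>p=1..m + n. y' p *\<^sub>R e p)" "(\<Sum>p=1..m + n. y' p) = 0" by blast
    thus "x + x' \<in> ?W"
      using y by (auto simp: scaleR_left_distrib sum.distrib intro!: exI[of _ "\<lambda>p. y p + y' p"])
  qed
  fix S assume S: "S \<in> ?I"
  show "finite (?C S)" by (simp add: finite_facet_sets)
  show "y = 0" if y: "y \<in> ?W" and zero: "\<And>c. c \<in> ?C S \<Longrightarrow> c \<bullet> y = 0" for y
  proof -
    obtain z where z: "y = (\<Sum>p=1..m + n. z p *\<^sub>R e p)" "(\<Sum>p=1..m + n. z p) = 0"
      using y by blast
    have "z p = 0" if "p \<in> {1..m + n}" for p
    proof (rule facet_sets_separating[OF unary_shades_lower_part[OF S]])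
      show "sum z U = 0" if "U \<in> facet_sets (m + n) S" for U
        using zero[of "facet_normal U"] that
          inner_facet_normal[OF facet_sets_subset_coords[OF S that]] by (simp add: z)
    qed (use z(2) that S in \<open>auto simp: support_unary_shade\<close>)
    thus ?thesis by (simp add: z)
  qed
  show "\<exists>T\<in>?I. rotation_adj S T \<and> S \<noteq> T \<and> (\<forall>c'\<in>?C S - {c}. c' \<bullet> ?a T = c' \<bullet> ?a S)" if "c \<in> ?C S" for c
  proof -
    obtain U where U: "U \<in> facet_sets (m + n) S" "c = facet_normal U" using \<open>c \<in> ?C S\<close> by blast
    obtain T where T: "T \<in> ?I" "rotation_adj S T" "facet_sets (m + n) S \<subseteq> insert U (facet_sets (m + n) T)"
      using facet_sets_neighbour[OF S U(1)] by blast
    \<comment> \<open>A rotation changes the value of \<open>omega_dir\<close>, hence is never a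
      loop.\<close>
    have "S \<noteq> T" using rotation_adj_omega(2)[OF T(2) S T(1)] by auto
    moreover have "c' \<bullet> ?a T = c' \<bullet> ?a S" if "c' \<in> ?C S - {c}" for c'
      using that T(3) inner_facet_normal_eq[OF S T(1)] U(2) by auto
    ultimately show ?thesis using T by blast
  qed
  fix T assume T: "T \<in> ?I"
  show "?a T - ?a S \<in> ?W"
    using sum_coord_unary_shade[OF S] sum_coord_unary_shade[OF T]
    by (auto simp: hoch_point_coord S T sum_subtractf scaleR_left_diff_distrib
        intro!: exI[of _ "\<lambda>p. coord (m + n) T p - coord (m + n) S p"])
  show "c \<bullet> ?a S \<le> c \<bullet> ?a T" if "c \<in> ?C S" for c
    using that sum_coord_facet_set_le[OF S _ T] by (auto simp: inner_facet_normal_hoch_point[OF S] S T)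
  show "S \<noteq> T \<and> (\<exists>c\<in>?C S. \<forall>c'\<in>?C S - {c}. c' \<bullet> ?a T = c' \<bullet> ?a S)" if adj: "rotation_adj S T"
  proof -
    obtain U where U: "U \<in> facet_sets (m + n) S" "facet_sets (m + n) S \<subseteq> insert U (facet_sets (m + n) T)"
      using adj facet_sets_right_rotation(1)[OF _ S] facet_sets_right_rotation(2)[OF _ T]
      unfolding rotation_adj_def by metis
    have "S \<noteq> T" using rotation_adj_omega(2)[OF adj S T] by auto
    moreover have "c' \<bullet> ?a T = c' \<bullet> ?a S" if "c' \<in> ?C S - {facet_normal U}" for c'
      using that U(2) inner_facet_normal_eq[OF S T] by auto
    ultimately show ?thesis using U(1) by blast
  qed
qed

end

theorem proposition59:
  fixes m n :: nat and e :: "nat \<Rightarrow> 'a::euclidean_space"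
  assumes "coord_basis (m + n) e"
  shows "generic_direction (omega_dir e (m + n)) (Hoch e m n) \<and>
    digraph_iso (with_proj (oriented_skeleton (omega_dir e (m + n)) (Hoch e m n)))
      (with_proj (right_rotation_digraph m n))"
proof
  let ?I = "unary_shades m n" and ?a = "hoch_point e m n" and ?w = "omega_dir e (m + n)"
  interpret simple_polytope ?I ?a "{\<Sum>p=1..m + n. y p *\<^sub>R e p | y. (\<Sum>p=1..m + n. y p) = 0}"
    "\<lambda>S. facet_normal e ` facet_sets (m + n) S" rotation_adj
    by (rule simple_polytope_Hoch[OF assms])
  note omega = rotation_adj_omega[OF assms]
  show "generic_direction ?w (Hoch e m n)"
    unfolding generic_direction_def Hoch_def using omega(2) by (auto simp: edge_of_iff)
  let ?G = "with_proj (oriented_skeleton ?w (Hoch e m n))"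
  define b where "b = inv_into ?I ?a"
  define h :: "('a, 'a \<times> 'a, shade, shade \<times> shade) digraph_isomorphism" where
    "h = \<lparr>iso_verts = b, iso_arcs = map_prod b b, iso_head = snd, iso_tail = fst\<rparr>"
  have b [simp]: "b (?a S) = S" if "S \<in> ?I" for S
    unfolding b_def using inj_a that by simp
  have verts: "verts ?G = ?a ` ?I"
    by (auto simp: oriented_skeleton_def Hoch_def extreme_point)
  \<comment> \<open>Edges are rotations in either direction; the orientation by \<open>?w\<close>
    keeps exactly the right ones.\<close>
  have "arcs ?G = {(u, v). \<exists>S\<in>?I. \<exists>T\<in>?I. u = ?a S \<and> v = ?a T \<and> right_rotation S T}"
    using omega(1) by (auto simp: oriented_skeleton_def Hoch_def edge_of_iff rotation_adj_def)
  hence arcs: "arcs ?G = map_prod ?a ?a ` parcs (right_rotation_digraph m n)"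
    by (auto simp: right_rotation_digraph_def image_iff)
  have "wf_digraph ?G"
    by unfold_locales (auto simp: arcs verts right_rotation_digraph_def simp del: with_proj_simps(1,2))
  moreover have "inj_on b (verts ?G)" unfolding verts by (rule inj_onI) auto
  moreover have "inj_on (map_prod b b) (arcs ?G)"
    unfolding arcs by (rule inj_onI) (auto simp: right_rotation_digraph_def)
  ultimately have "pre_digraph.digraph_isomorphism ?G h"
    unfolding pre_digraph.digraph_isomorphism_def h_def by auto
  moreover have "with_proj (right_rotation_digraph m n) = app_iso h ?G"
    unfolding app_iso_def verts arcs h_def
    by (force simp: with_proj_def right_rotation_digraph_def image_image)
  ultimately show "digraph_iso ?G (with_proj (right_rotation_digraph m n))"
    unfolding digraph_iso_def by blast
qed

end
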